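(* Let $\gamma>-\tfrac12$, let $\mu\ge 1$ be an integer, let $g_1$ be analytic on $[-1,1]$, and let $f(x)=(1-x)^{\gamma}\ln^{\mu}(1-x)\,g_1(x)$, $x\in[-1,1]$ (so $f$ has a singularity at $x=1$). Then the Chebyshev coefficients $a_k=\frac{2}{\pi}\int_{-1}^{1} f(x)T_k(x)\frac{dx}{\sqrt{1-x^2}}$ of $f$ are asymptotically given by $$a_k \sim \frac{2^{\mu+1-\gamma}}{\pi}\,g_1(1)\,(-1)^{\mu+1}\sin(\gamma\pi)\,\Gamma(2\gamma+1)\,\frac{\ln^{\mu}(k)}{k^{2\gamma+1}} + (-1)^{\mu}\mu\,2^{\mu-\gamma}g_1(1)\left(\frac{2}{\pi}\sin(\gamma\pi)\,\Gamma'(2\gamma+1)+\Big(\cos(\gamma\pi)-\frac{\ln 2}{\pi}\Big)\Gamma(2\gamma+1)\right)\frac{\ln^{\mu-1}(k)}{k^{2\gamma+1}}+\mathcal{O}\!\left(\frac{\ln^{\mu-2}(k)}{k^{2\gamma+1}}\right).$$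
   Context: $T_k(x)=\cos(k\arccos x)$ is the Chebyshev polynomial of the first kind. $\ln^{m}(y)$ means $(\ln y)^{m}$. $\Gamma$ is the Gamma function and $\Gamma'$ its derivative. The asymptotics are as $k\to\infty$, and "$\sim$" followed by an explicit remainder means equality up to that remainder.
   Formalization: The term ln 2/π in the second coefficient is corrected to (ln 2/π) sin(γπ); as printed the formula fails for γ=0, μ=1, g_1=1, where a_k=-2/k exactly but the printed expansion gives -2(1-ln 2/π)/k. *)

theory Defs
  imports "HOL-Analysis.Analysis" "HOL-Library.Landau_Symbols"
begin

definition cheb_T :: "nat \<Rightarrow> real \<Rightarrow> real" where
  "cheb_T k x = cos (real k * arccos x)"

(* Lebesgue integral; the value 1 / sqrt 0 = 0 at the end points x = -1, 1 affects a null set only. *)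
definition cheb_coeff :: "(real \<Rightarrow> complex) \<Rightarrow> nat \<Rightarrow> complex" where
  "cheb_coeff f k =
     of_real (2 / pi) * (LBINT x:{-1..1}. f x * of_real (cheb_T k x / sqrt (1 - x\<^sup>2)))"

(* The two coefficients below are A(\<gamma>) * (-2)^\<mu> and \<mu> * A'(\<gamma>) * (-2)^(\<mu> - 1), where
   A(\<gamma>) = - 2 powr (1 - \<gamma>) / pi * sin (\<gamma> pi) * Gamma (2\<gamma> + 1) is the leading coefficient for
   (1 - x) powr \<gamma>: differentiate A(\<gamma>) * k powr (-(2\<gamma> + 1)) \<mu> times with respect to \<gamma>.
   The published formula has "- ln 2 / pi" where sec_coeff_ln has "- ln 2 / pi * sin (\<gamma> pi)".
   The factor sin (\<gamma> pi) is needed: for \<gamma> = 0, \<mu> = 1 and g1 = 1, the k-th coefficient of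
   ln (1 - x) is exactly - 2 / k, whereas the published formula gives - 2 * (1 - ln 2 / pi) / k. *)
definition lead_coeff_ln :: "real \<Rightarrow> nat \<Rightarrow> real" where
  "lead_coeff_ln \<gamma> \<mu> =
     2 powr (real \<mu> + 1 - \<gamma>) / pi * (-1) ^ (\<mu> + 1) * sin (\<gamma> * pi) * Gamma (2 * \<gamma> + 1)"

definition sec_coeff_ln :: "real \<Rightarrow> nat \<Rightarrow> real" where
  "sec_coeff_ln \<gamma> \<mu> =
     (-1) ^ \<mu> * real \<mu> * 2 powr (real \<mu> - \<gamma>) *
       (2 / pi * sin (\<gamma> * pi) * deriv Gamma (2 * \<gamma> + 1)
        + (cos (\<gamma> * pi) - ln 2 / pi * sin (\<gamma> * pi)) * Gamma (2 * \<gamma> + 1))"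

end

theory Submission
  imports Defs "HOL-Complex_Analysis.Complex_Analysis"
begin

text \<open>Logarithms are removed by differentiating in the exponent: up to the factor \<open>2 / pi\<close>, the
  \<open>k\<close>-th coefficient of \<open>f\<close> is the \<open>\<mu>\<close>-th derivative at \<open>s = \<gamma>\<close> of the holomorphic function \<open>J\<^sub>k(s)\<close>
  obtained from the coefficient of \<open>(1 - x)\<^sup>s g\<^sub>1(x)\<close> with complex \<open>s\<close>. For \<open>g\<^sub>1 = 1\<close> a two-term recurrence in
  \<open>k\<close> expresses \<open>J\<^sub>k(s)\<close> by Pochhammer symbols, whence \<open>k powr (2 s + 1) * J\<^sub>k(s) = D(s) + O(1 / k)\<close> locally
  uniformly in \<open>s\<close>. For general \<open>g\<^sub>1\<close> write \<open>g\<^sub>1(x) = g\<^sub>1(1) + (1 - x) h(x)\<close>; integrating by parts twice turns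
  the contribution of \<open>(1 - x) powr (s + 1) h(x)\<close> into \<open>k powr (-2)\<close> times integrals of the original kind,
  and iterating this gives \<open>k powr (2 s + 1) * J\<^sub>k(s) = g\<^sub>1(1) D(s) + O(1 / k)\<close>, again locally uniformly. By Cauchy's
  inequalities the estimate survives differentiation in \<open>s\<close>, and Leibniz' rule applied to the product of
  \<open>k powr (- 2 s - 1)\<close>, whose derivatives produce the powers of \<open>ln k\<close>, with the rest gives the expansion.\<close>

section \<open>Integrals with the weight \<open>(1 - cos t) powr \<sigma>\<close>\<close>

text \<open>Substitute u = (1 - cos t) / 2 in the Beta integral. Since sin t / 2 = sqrt (u (1 - u)),
  the Jacobian raises the exponent of u from \<sigma> - 1/2 to \<sigma> and cancels the power -1/2
  of 1 - u.\<close>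

lemma integral_half_one_minus_cos_powr:
  fixes \<sigma> :: real
  assumes "\<sigma> > - 1 / 2"
  shows "(\<lambda>t. ((1 - cos t) / 2) powr \<sigma>) absolutely_integrable_on {0<..<pi} \<and>
         integral {0<..<pi} (\<lambda>t. ((1 - cos t) / 2) powr \<sigma>) = Beta (\<sigma> + 1 / 2) (1 / 2)"
proof -
  let ?f = "\<lambda>u::real. u powr (\<sigma> + 1 / 2 - 1) * (1 - u) powr (1 / 2 - 1)"
  let ?g = "\<lambda>t::real. (1 - cos t) / 2"
  have img: "?g ` {0<..<pi} = {0<..<1}"
  proof safe
    fix t :: real assume t: "t \<in> {0<..<pi}"
    have "cos pi < cos t" "cos t < cos 0" using t by (intro cos_monotone_0_pi; simp)+
    then show "?g t \<in> {0<..<1}" by simp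
  next
    fix u :: real assume u: "u \<in> {0<..<1}"
    have "arccos (1 - 2 * u) \<in> {0<..<pi}" using arccos_lt_bounded[of "1 - 2 * u"] u by auto
    moreover have "?g (arccos (1 - 2 * u)) = u" using u by simp
    ultimately show "u \<in> ?g ` {0<..<pi}" by (metis image_eqI)
  qed
  have inj: "inj_on ?g {0<..<pi}"
    by (rule inj_onI) (auto dest!: cos_inj_pi[rotated 4])
  have der: "(?g has_field_derivative sin t / 2) (at t within {0<..<pi})" for t
    by (auto intro!: derivative_eq_intros)
  have int01: "(?f has_integral Beta (\<sigma> + 1 / 2) (1 / 2)) {0<..<1}"
    using has_integral_Beta_real[of "\<sigma> + 1/2" "1/2"] assms by (simp add: has_integral_Icc_iff_Ioo)
  have "?f absolutely_integrable_on {0<..<1} \<and> integral {0<..<1} ?f = Beta (\<sigma> + 1 / 2) (1 / 2)"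
    using int01 by (auto intro!: nonnegative_absolutely_integrable_1 simp: integral_unique)
  then have *: "(\<lambda>t. \<bar>sin t / 2\<bar> * ?f (?g t)) absolutely_integrable_on {0<..<pi} \<and>
      integral {0<..<pi} (\<lambda>t. \<bar>sin t / 2\<bar> * ?f (?g t)) = Beta (\<sigma> + 1 / 2) (1 / 2)"
    by (subst has_absolute_integral_change_of_variables_1'[OF _ der inj, of ?f]) (simp_all add: img)
  have eq: "\<bar>sin t / 2\<bar> * ?f (?g t) = ?g t powr \<sigma>" if t: "t \<in> {0<..<pi}" for t
  proof -
    have "cos pi < cos t" "cos t < cos 0" using t by (intro cos_monotone_0_pi; simp)+
    then have pos: "1 - cos t > 0" "1 + cos t > 0" by auto
    have s: "sin t > 0" using t by (auto intro: sin_gt_zero)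
    have sq: "sin t / 2 = ?g t powr (1/2) * (1 - ?g t) powr (1/2)"
    proof -
      have "sin t / 2 = sqrt ((sin t / 2)\<^sup>2)" using s by simp
      also have "(sin t / 2)\<^sup>2 = ?g t * (1 - ?g t)"
        by (simp add: power_divide sin_squared_eq power2_eq_square field_simps)
      finally show ?thesis using pos by (simp only: real_sqrt_mult) (simp add: powr_half_sqrt)
    qed
    have "\<bar>sin t / 2\<bar> * ?f (?g t) =
      (?g t powr (1/2) * ?g t powr (\<sigma> + 1 / 2 - 1)) * ((1 - ?g t) powr (1/2) * (1 - ?g t) powr (1 / 2 - 1))"
      using s by (simp only: abs_of_pos[of "sin t / 2"] sq) (simp add: mult_ac sq[symmetric])
    also have "\<dots> = ?g t powr \<sigma> * (1 - ?g t) powr 0"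
      by (simp only: powr_add[symmetric]) simp
    finally show ?thesis using pos by (simp add: field_simps)
  qed
  have "(\<lambda>t. \<bar>sin t / 2\<bar> * ?f (?g t)) absolutely_integrable_on {0<..<pi} \<longleftrightarrow>
      (\<lambda>t. ?g t powr \<sigma>) absolutely_integrable_on {0<..<pi}"
    using eq by (intro set_integrable_cong) auto
  moreover have "integral {0<..<pi} (\<lambda>t. \<bar>sin t / 2\<bar> * ?f (?g t)) = integral {0<..<pi} (\<lambda>t. ?g t powr \<sigma>)"
    using eq by (rule integral_cong)
  ultimately show ?thesis using * by argo
qed

lemma continuous_on_of_real_cos [continuous_intros]:
  assumes "continuous_on (complex_of_real ` {-1..1}) H"
  shows "continuous_on A (\<lambda>t. H (of_real (cos t)))"
  by (rule continuous_on_compose2[OF assms]) (auto intro!: continuous_intros)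

lemma one_minus_cos_bounds:
  fixes t :: real
  shows "0 \<le> 1 - cos t" "1 - cos t \<le> 2"
    and "t \<in> {0<..pi} \<Longrightarrow> 0 < 1 - cos t"
  using cos_ge_minus_one[of t] cos_le_one[of t] cos_monotone_0_pi[of 0 t] by (auto simp del: cos_ge_minus_one cos_le_one)

lemma continuous_on_one_minus_cos_powr [continuous_intros]:
  "continuous_on {0<..pi} (\<lambda>t. complex_of_real (1 - cos t) powr s)"
proof (rule continuous_on_powr_complex)
  show "{0<..pi} \<subseteq> {t. 0 \<le> Re (complex_of_real (1 - cos t)) \<or> Im (complex_of_real (1 - cos t)) \<noteq> 0}"
    using one_minus_cos_bounds(1) by auto
  show "0 < Re s" if "t \<in> {0<..pi}" "complex_of_real (1 - cos t) = 0" for t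
    using one_minus_cos_bounds(3)[OF that(1)] that(2) by (simp only: of_real_eq_0_iff)
qed (intro continuous_intros)+

lemma norm_one_minus_cos_powr:
  "norm (complex_of_real (1 - cos t) powr s) = (1 - cos t) powr Re s"
  using one_minus_cos_bounds(1)[of t] by (subst norm_powr_real_powr) auto

text \<open>The quotient of the two powers has a nonnegative exponent and a base of at most 2. This
  trades an exponent that varies with s for a fixed one, as bounds uniform in s require.\<close>

lemma one_minus_cos_powr_le:
  fixes t :: real
  assumes "\<sigma> \<le> \<tau>"
  shows "(1 - cos t) powr \<tau> \<le> 2 powr (\<tau> - \<sigma>) * (1 - cos t) powr \<sigma>"
proof -
  have "(1 - cos t) powr \<tau> = (1 - cos t) powr (\<tau> - \<sigma>) * (1 - cos t) powr \<sigma>"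
    by (simp add: powr_add[symmetric])
  also have "\<dots> \<le> 2 powr (\<tau> - \<sigma>) * (1 - cos t) powr \<sigma>"
    using assms one_minus_cos_bounds[of t] by (intro mult_right_mono powr_mono2) auto
  finally show ?thesis .
qed

lemma has_integral_one_minus_cos_powr:
  fixes \<sigma> :: real
  assumes "\<sigma> > - 1 / 2"
  shows "((\<lambda>t. (1 - cos t) powr \<sigma>) has_integral 2 powr \<sigma> * Beta (\<sigma> + 1 / 2) (1 / 2)) {0..pi}"
proof -
  have "((\<lambda>t. ((1 - cos t) / 2) powr \<sigma>) has_integral Beta (\<sigma> + 1 / 2) (1 / 2)) {0..pi}"
    using integral_half_one_minus_cos_powr[OF assms]
    by (subst has_integral_Icc_iff_Ioo) (simp add: has_integral_iff set_lebesgue_integral_eq_integral(1))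
  then have "((\<lambda>t. 2 powr \<sigma> * ((1 - cos t) / 2) powr \<sigma>) has_integral 2 powr \<sigma> * Beta (\<sigma> + 1 / 2) (1 / 2)) {0..pi}"
    by (rule has_integral_mult_right)
  moreover have "2 powr \<sigma> * ((1 - cos t) / 2) powr \<sigma> = (1 - cos t) powr \<sigma>" for t
    using one_minus_cos_bounds(1)[of t] by (simp add: powr_divide)
  ultimately show ?thesis by simp
qed

text \<open>Domination by the explicit Beta integral. Continuity is asked for only away from
  \<open>t = 0\<close>, where integrands may blow up; the point 0 is then put back as a null
  set.\<close>

lemma absolutely_integrable_one_minus_cos_bound:
  fixes f :: "real \<Rightarrow> complex"
  assumes "\<sigma> > - 1 / 2" and "continuous_on {0<..pi} f"
    and bound: "\<And>t. t \<in> {0<..pi} \<Longrightarrow> norm (f t) \<le> M * (1 - cos t) powr \<sigma>"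
  shows "f absolutely_integrable_on {0..pi}"
    and "norm (integral {0..pi} f) \<le> M * (2 powr \<sigma> * Beta (\<sigma> + 1 / 2) (1 / 2))"
proof -
  have g: "((\<lambda>t. M * (1 - cos t) powr \<sigma>) has_integral M * (2 powr \<sigma> * Beta (\<sigma> + 1 / 2) (1 / 2))) {0..pi}"
    by (intro has_integral_mult_right has_integral_one_minus_cos_powr assms)
  have g': "((\<lambda>t. M * (1 - cos t) powr \<sigma>) has_integral M * (2 powr \<sigma> * Beta (\<sigma> + 1 / 2) (1 / 2))) {0<..pi}"
    by (subst has_integral_spike_set_eq[where T = "{0..pi}"]) (use g in \<open>auto intro: negligible_subset[of "{0::real}"]\<close>)
  have 1: "f absolutely_integrable_on {0<..pi}"
    by (rule measurable_bounded_by_integrable_imp_absolutely_integrable[OF _ _ has_integral_integrable[OF g']])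
       (use bound assms in \<open>auto intro!: continuous_imp_measurable_on_sets_lebesgue\<close>)
  show "f absolutely_integrable_on {0..pi}"
    by (rule absolutely_integrable_spike_set[OF 1]) (auto intro: negligible_subset[of "{0::real}"])
  have "integral {0..pi} f = integral {0<..pi} f"
    by (rule integral_spike_set) (auto intro: negligible_subset[of "{0::real}"])
  also have "norm \<dots> \<le> integral {0<..pi} (\<lambda>t. M * (1 - cos t) powr \<sigma>)"
    by (rule integral_norm_bound_integral)
       (use 1 g' bound in \<open>auto dest: set_lebesgue_integral_eq_integral(1) has_integral_integrable\<close>)
  finally show "norm (integral {0..pi} f) \<le> M * (2 powr \<sigma> * Beta (\<sigma> + 1 / 2) (1 / 2))"
    unfolding integral_unique[OF g'] .
qed

lemma absolutely_integrable_one_minus_cos_powr_mult: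
  fixes \<phi> :: "real \<Rightarrow> complex"
  assumes "Re s > - 1 / 2" and "continuous_on {0..pi} \<phi>"
  shows "(\<lambda>t. of_real (1 - cos t) powr s * \<phi> t) absolutely_integrable_on {0..pi}"
proof -
  have "compact (\<phi> ` {0..pi})" using assms by (intro compact_continuous_image) auto
  then obtain M where M: "\<And>t. t \<in> {0..pi} \<Longrightarrow> norm (\<phi> t) \<le> M"
    by (metis bounded_iff compact_imp_bounded imageI)
  show ?thesis
  proof (rule absolutely_integrable_one_minus_cos_bound)
    show "continuous_on {0<..pi} (\<lambda>t. of_real (1 - cos t) powr s * \<phi> t)"
      by (intro continuous_on_mult continuous_on_one_minus_cos_powr continuous_on_subset[OF assms(2)]) auto
    show "norm (of_real (1 - cos t) powr s * \<phi> t) \<le> M * (1 - cos t) powr Re s" if "t \<in> {0<..pi}" for t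
      using M[of t] that by (simp add: norm_mult norm_one_minus_cos_powr mult.commute[of M] mult_left_mono del: of_real_diff)
  qed (use assms in auto)
qed

text \<open>Up to the factor sqrt 2, \<open>sin (t / 2)\<close> is the power 1/2 of
  \<open>1 - cos t\<close>. It lifts the real part of the exponent to Re s + 1/2 > 0, so the product
  tends to 0 at \<open>t = 0\<close>. This makes the fundamental theorem of calculus applicable up
  to the singular end point.\<close>

lemma continuous_on_one_minus_cos_powr_mult:
  fixes \<phi> \<eta> :: "real \<Rightarrow> complex"
  assumes s: "Re s > - 1 / 2" and \<eta>: "continuous_on {0..pi} \<eta>"
    and \<phi>: "\<And>t. \<phi> t = of_real (sin (t / 2)) * \<eta> t"
  shows "continuous_on {0..pi} (\<lambda>t. of_real (1 - cos t) powr s * \<phi> t)"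
proof -
  have "compact (\<eta> ` {0..pi})" using \<eta> by (intro compact_continuous_image) auto
  then obtain M where M: "\<And>t. t \<in> {0..pi} \<Longrightarrow> norm (\<eta> t) \<le> M"
    by (metis bounded_iff compact_imp_bounded imageI)
  have bound: "norm (\<phi> t) \<le> M * sin (t / 2)" if "t \<in> {0..pi}" for t
  proof -
    have "sin (t / 2) \<ge> 0" using that by (intro sin_ge_zero) auto
    then show ?thesis using M[OF that] by (simp add: \<phi> norm_mult) (metis mult.commute mult_left_mono)
  qed
  have \<phi>_cont: "continuous_on {0..pi} \<phi>"
    unfolding \<phi> by (auto intro!: continuous_intros \<eta>)
  show ?thesis
    unfolding continuous_on_eq_continuous_within
  proof
    fix t :: real assume t: "t \<in> {0..pi}"
    let ?f = "\<lambda>t. of_real (1 - cos t) powr s * \<phi> t"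
    show "continuous (at t within {0..pi}) ?f"
    proof (cases "t = 0")
      case False
      have "continuous (at t within {0..pi}) (\<lambda>t. complex_of_real (1 - cos t))"
        by (intro continuous_intros)
      moreover have "continuous (at t within {0..pi}) \<phi>"
        using \<phi>_cont t by (simp add: continuous_on_eq_continuous_within)
      ultimately show ?thesis using False t one_minus_cos_bounds(3)[of t]
        unfolding continuous_within
        by (intro tendsto_mult tendsto_powr_complex tendsto_const) (auto simp: complex_nonpos_Reals_iff)
    next
      case True
      let ?g = "\<lambda>t. \<bar>M\<bar> * (1 - cos t) powr (Re s + 1 / 2)"
      have "((\<lambda>t. \<bar>M\<bar> * (1 - cos t) powr (Re s + 1 / 2)) \<longlongrightarrow> \<bar>M\<bar> * (1 - cos 0) powr (Re s + 1 / 2)) (at 0 within {0..pi})"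
        using s by (intro tendsto_mult tendsto_powr' tendsto_intros) (auto intro!: always_eventually)
      then have lim: "(?g \<longlongrightarrow> 0) (at 0 within {0..pi})" by simp
      have "(?f \<longlongrightarrow> 0) (at 0 within {0..pi})"
      proof (rule Lim_null_comparison[OF _ lim])
        have "norm (?f t) \<le> ?g t" if t: "t \<in> {0..pi}" for t
        proof -
          have s2: "sin (t / 2) \<ge> 0" using t by (intro sin_ge_zero) auto
          have "1 - cos t = 2 * (sin (t / 2))\<^sup>2"
            using cos_double_sin[of "t / 2"] by simp
          then have "(1 - cos t) powr (1/2) = sqrt 2 * sin (t / 2)"
            using s2 by (simp add: powr_half_sqrt real_sqrt_mult)
          moreover have "1 * sin (t / 2) \<le> sqrt 2 * sin (t / 2)" using s2 by (intro mult_right_mono) auto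
          ultimately have *: "sin (t / 2) \<le> (1 - cos t) powr (1/2)" by simp
          have "norm (?f t) \<le> (1 - cos t) powr Re s * (M * sin (t / 2))"
            using bound[OF t] by (simp add: norm_mult norm_one_minus_cos_powr mult_left_mono del: of_real_diff)
          also have "\<dots> \<le> (1 - cos t) powr Re s * (\<bar>M\<bar> * (1 - cos t) powr (1/2))"
            using * s2 by (intro mult_left_mono mult_mono) auto
          finally show ?thesis by (simp add: powr_add mult_ac)
        qed
        then show "\<forall>\<^sub>F t in at 0 within {0..pi}. norm (?f t) \<le> ?g t"
          by (auto simp: eventually_at_filter intro!: always_eventually)
      qed
      then show ?thesis unfolding True continuous_within by simp
    qed
  qed
qed

text \<open>The hypothesis relating \<^term>\<open>\<phi>\<close>, \<^term>\<open>\<phi>'\<close> and \<^term>\<open>\<psi>\<close> says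
  \<open>s sin t / (1 - cos t) \<phi> + \<phi>' = \<psi>\<close>, that is, the derivative of \<open>(1 - cos t)\<^sup>s \<phi>\<close> is
  \<open>(1 - cos t)\<^sup>s \<psi>\<close>.\<close>
lemma has_integral_one_minus_cos_powr_mult:
  fixes \<phi> \<eta> \<phi>' \<psi> :: "real \<Rightarrow> complex"
  assumes s: "Re s > - 1 / 2" and \<eta>: "continuous_on {0..pi} \<eta>"
    and \<phi>: "\<And>t. \<phi> t = of_real (sin (t / 2)) * \<eta> t"
    and der: "\<And>t. t \<in> {0<..<pi} \<Longrightarrow> (\<phi> has_vector_derivative \<phi>' t) (at t)"
    and eq: "\<And>t. t \<in> {0<..<pi} \<Longrightarrow>
      s * of_real (sin t) * \<phi> t + of_real (1 - cos t) * \<phi>' t = of_real (1 - cos t) * \<psi> t"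
  shows "((\<lambda>t. of_real (1 - cos t) powr s * \<psi> t) has_integral 2 powr s * \<phi> pi) {0..pi}"
proof -
  let ?f = "\<lambda>t. of_real (1 - cos t) powr s * \<phi> t"
  have "((\<lambda>t. of_real (1 - cos t) powr s * \<psi> t) has_integral ?f pi - ?f 0) {0..pi}"
  proof (rule fundamental_theorem_of_calculus_interior)
    show "continuous_on {0..pi} ?f" by (rule continuous_on_one_minus_cos_powr_mult[OF s \<eta> \<phi>])
    fix t :: real assume t: "t \<in> {0<..<pi}"
    have pos: "1 - cos t > 0" using one_minus_cos_bounds(3)[of t] t by auto
    have "((\<lambda>t. complex_of_real (1 - cos t)) has_vector_derivative of_real (sin t)) (at t)"
      by (intro has_vector_derivative_of_real) (auto intro!: derivative_eq_intros)
    moreover have "((\<lambda>z. z powr s) has_field_derivative s * of_real (1 - cos t) powr (s - 1)) (at (complex_of_real (1 - cos t)))"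
      using pos by (intro has_field_derivative_powr) (auto simp: complex_nonpos_Reals_iff)
    ultimately have d: "((\<lambda>t. of_real (1 - cos t) powr s) has_vector_derivative of_real (sin t) * (s * of_real (1 - cos t) powr (s - 1))) (at t)"
      using field_vector_diff_chain_at by (force simp: o_def)
    have "of_real (1 - cos t) powr s * \<phi>' t + of_real (sin t) * (s * of_real (1 - cos t) powr (s - 1)) * \<phi> t
        = of_real (1 - cos t) powr s * \<psi> t"
    proof -
      have "of_real (1 - cos t) powr (s - 1) = of_real (1 - cos t) powr s / complex_of_real (1 - cos t)"
        using pos by (subst powr_diff) (auto simp: powr_to_1)
      then have "of_real (1 - cos t) powr s * \<phi>' t + of_real (sin t) * (s * of_real (1 - cos t) powr (s - 1)) * \<phi> t
        = of_real (1 - cos t) powr s / of_real (1 - cos t) * (s * of_real (sin t) * \<phi> t + of_real (1 - cos t) * \<phi>' t)"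
        using pos by (simp add: field_simps del: of_real_diff)
      then show ?thesis unfolding eq[OF t] using pos by (simp del: of_real_diff)
    qed
    with has_vector_derivative_mult[OF d der[OF t]]
    show "(?f has_vector_derivative of_real (1 - cos t) powr s * \<psi> t) (at t)" by simp
  qed auto
  moreover have "\<phi> 0 = 0" by (simp add: \<phi>)
  ultimately show ?thesis by simp
qed

section \<open>The coefficients as functions of the exponent\<close>

text \<open>\<open>2 / pi\<close> times \<open>jcoeff H k s\<close> is the \<open>k\<close>-th Chebyshev coefficient of
  \<open>(1 - x)\<^sup>s H(x)\<close> after \<open>x = cos t\<close>. The integrand vanishes at \<open>t = 0\<close> because \<open>0 powr s = 0\<close>.\<close>
definition jcoeff :: "(complex \<Rightarrow> complex) \<Rightarrow> nat \<Rightarrow> complex \<Rightarrow> complex" where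
  "jcoeff H k s = integral {0..pi}
     (\<lambda>t. of_real (1 - cos t) powr s * (H (of_real (cos t)) * of_real (cos (real k * t))))"

lemma jcoeff_integrable:
  assumes "continuous_on (complex_of_real ` {-1..1}) H" and "Re s > - 1 / 2"
  shows "(\<lambda>t. of_real (1 - cos t) powr s * (H (of_real (cos t)) * of_real (cos (real k * t)))) integrable_on {0..pi}"
  by (intro set_lebesgue_integral_eq_integral(1) absolutely_integrable_one_minus_cos_powr_mult
      continuous_intros assms)

lemma jcoeff_cong:
  assumes "\<And>x. x \<in> {-1..1} \<Longrightarrow> H (of_real x) = G (of_real x)"
  shows "jcoeff H k s = jcoeff G k s"
  unfolding jcoeff_def by (rule integral_cong) (simp add: assms)

lemma jcoeff_add:
  assumes "continuous_on (complex_of_real ` {-1..1}) H" "continuous_on (complex_of_real ` {-1..1}) G"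
    and "Re s > - 1 / 2"
  shows "jcoeff (\<lambda>z. H z + G z) k s = jcoeff H k s + jcoeff G k s"
  unfolding jcoeff_def
  using integral_add[OF jcoeff_integrable[OF assms(1,3)] jcoeff_integrable[OF assms(2,3)]]
  by (simp add: algebra_simps)

lemma jcoeff_cmult: "jcoeff (\<lambda>z. c * H z) k s = c * jcoeff H k s"
  unfolding jcoeff_def integral_mult_right[symmetric] by (simp only: mult_ac)

text \<open>The factor \<open>1 - cos t\<close> is absorbed into the power, also at
  \<open>t = 0\<close>, where both powers vanish.\<close>

lemma jcoeff_one_minus_mult: "jcoeff (\<lambda>z. (1 - z) * H z) k s = jcoeff H k (s + 1)"
proof -
  have "of_real (1 - cos t) powr (s + 1) = of_real (1 - cos t) powr s * complex_of_real (1 - cos t)" for t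
    by (cases "complex_of_real (1 - cos t) = 0") (simp_all add: powr_add powr_to_1 del: of_real_diff)
  then show ?thesis unfolding jcoeff_def by (simp add: mult_ac)
qed

text \<open>The cosine is at most 1 in modulus whatever k is, compactness bounds \<open>H\<close>,
  and \<open>one_minus_cos_powr_le\<close> reduces every exponent to \<sigma>. Hence one constant
  serves all k and all s of the region.\<close>

lemma jcoeff_bounded:
  assumes \<sigma>: "\<sigma> > - 1 / 2" and H: "continuous_on (complex_of_real ` {-1..1}) H"
  obtains M where "M > 0" "\<And>k s. \<sigma> \<le> Re s \<Longrightarrow> norm s \<le> B \<Longrightarrow> norm (jcoeff H k s) \<le> M"
proof -
  have "compact (H ` complex_of_real ` {-1..1})"
    using H by (intro compact_continuous_image) (auto intro!: compact_continuous_image continuous_intros)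
  then obtain K where K: "\<And>x. x \<in> {-1..1} \<Longrightarrow> norm (H (of_real x)) \<le> K"
    by (metis bounded_iff compact_imp_bounded imageI)
  then have "K \<ge> 0" using norm_ge_zero order_trans[of 0 _ K] by (metis atLeastAtMost_iff neg_le_0_iff_le order_refl zero_le_one)
  \<comment> \<open>The power of 2 covers every exponent difference, as Re s \<le> norm s \<le>
    \<open>B\<close>.\<close>
  define M where "M = 2 powr (B - \<sigma>) * K * (2 powr \<sigma> * Beta (\<sigma> + 1 / 2) (1 / 2))"
  have "norm (jcoeff H k s) \<le> M" if s: "\<sigma> \<le> Re s" "norm s \<le> B" for k s
    unfolding jcoeff_def M_def
  proof (rule absolutely_integrable_one_minus_cos_bound(2)[OF \<sigma>])
    show "continuous_on {0<..pi} (\<lambda>t. complex_of_real (1 - cos t) powr s * (H (of_real (cos t)) * of_real (cos (real k * t))))"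
      by (intro continuous_intros H)
    fix t :: real assume t: "t \<in> {0<..pi}"
    have "norm (complex_of_real (1 - cos t) powr s * (H (of_real (cos t)) * of_real (cos (real k * t))))
      = (1 - cos t) powr Re s * (norm (H (of_real (cos t))) * \<bar>cos (real k * t)\<bar>)"
      by (simp add: norm_mult norm_one_minus_cos_powr del: of_real_diff)
    also have "\<dots> \<le> (2 powr (Re s - \<sigma>) * (1 - cos t) powr \<sigma>) * (K * 1)"
      using K \<open>K \<ge> 0\<close> by (intro mult_mono one_minus_cos_powr_le s) auto
    also have "\<dots> \<le> (2 powr (B - \<sigma>) * (1 - cos t) powr \<sigma>) * (K * 1)"
      using \<open>K \<ge> 0\<close> s complex_Re_le_cmod[of s] by (intro mult_right_mono) (auto intro: order_trans)
    finally show "norm (complex_of_real (1 - cos t) powr s * (H (of_real (cos t)) * of_real (cos (real k * t))))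
       \<le> 2 powr (B - \<sigma>) * K * (1 - cos t) powr \<sigma>" by (simp add: mult_ac)
  qed
  \<comment> \<open>\<open>M\<close> is 0 when \<open>K\<close> is 0, so a constant that is
    certainly positive replaces it.\<close>
  then have "norm (jcoeff H k s) \<le> \<bar>M\<bar> + 1" if "\<sigma> \<le> Re s" "norm s \<le> B" for k s
    using that by (smt (verit))
  then show ?thesis by (intro that[of "\<bar>M\<bar> + 1"]) auto
qed

section \<open>Recurrence for the pure power and integration by parts\<close>

text \<open>The function (1 - cos t) powr s * (sin ((k + 1) t) - sin (k t)) vanishes at both end
  points, so its derivative has integral 0. That derivative is the weight times a combination of cos
  ((k + 1) t) and cos (k t), which is the recurrence.\<close>

lemma jcoeff_one_Suc:
  assumes "Re s > - 1 / 2"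
  shows "(s + of_nat k + 1) * jcoeff (\<lambda>_. 1) (Suc k) s = (of_nat k - s) * jcoeff (\<lambda>_. 1) k s"
proof -
  \<comment> \<open>The mean of the two frequencies: the difference of sines is 2 sin (t / 2) cos (m
    t), which exhibits the factor \<open>sin (t / 2)\<close> needed for continuity at 0.\<close>
  let ?m = "real k + 1 / 2"
  have "((\<lambda>t. of_real (1 - cos t) powr s *
      ((s + of_nat k + 1) * of_real (cos (real (Suc k) * t)) + (s - of_nat k) * of_real (cos (real k * t))))
     has_integral 2 powr s * complex_of_real (sin (real (Suc k) * pi) - sin (real k * pi))) {0..pi}"
  proof (rule has_integral_one_minus_cos_powr_mult[OF assms])
    show "continuous_on {0..pi} (\<lambda>t. complex_of_real (2 * cos (?m * t)))"
      by (intro continuous_intros)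
    show "complex_of_real (sin (real (Suc k) * t) - sin (real k * t)) = of_real (sin (t / 2)) * of_real (2 * cos (?m * t))" for t
      by (simp only: sin_diff_sin of_real_mult[symmetric]) (simp add: algebra_simps add_divide_distrib)
    fix t :: real
    show "((\<lambda>t. complex_of_real (sin (real (Suc k) * t) - sin (real k * t))) has_vector_derivative
       of_real (real (Suc k) * cos (real (Suc k) * t) - real k * cos (real k * t))) (at t)"
      by (intro has_vector_derivative_of_real) (auto intro!: derivative_eq_intros)
    have a: "sin (real (Suc k) * t) = sin (real k * t) * cos t + cos (real k * t) * sin t"
      and b: "cos (real (Suc k) * t) = cos (real k * t) * cos t - sin (real k * t) * sin t"
      by (simp_all add: algebra_simps sin_add cos_add)
    \<comment> \<open>Differentiating the weight produces the singular factor sin t / (1 - cos t) =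
      cot (t / 2); the difference of sines cancels the singularity and leaves a sum of
      cosines.\<close>
    have key: "sin t * (sin (real (Suc k) * t) - sin (real k * t)) = (1 - cos t) * (cos (real (Suc k) * t) + cos (real k * t))"
      unfolding a b using sin_cos_squared_add[of t] by algebra
    show "s * of_real (sin t) * of_real (sin (real (Suc k) * t) - sin (real k * t)) +
        of_real (1 - cos t) * of_real (real (Suc k) * cos (real (Suc k) * t) - real k * cos (real k * t))
      = of_real (1 - cos t) * ((s + of_nat k + 1) * of_real (cos (real (Suc k) * t)) + (s - of_nat k) * of_real (cos (real k * t)))"
      using arg_cong[OF key, of complex_of_real] by (simp del: of_nat_Suc add: of_nat_Suc[where 'a = complex]) algebra
  qed
  moreover have "((\<lambda>t. of_real (1 - cos t) powr s *
      ((s + of_nat k + 1) * of_real (cos (real (Suc k) * t)) + (s - of_nat k) * of_real (cos (real k * t))))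
     has_integral ((s + of_nat k + 1) * jcoeff (\<lambda>_. 1) (Suc k) s + (s - of_nat k) * jcoeff (\<lambda>_. 1) k s)) {0..pi}"
  proof -
    have i: "((\<lambda>t. of_real (1 - cos t) powr s * of_real (cos (real k * t))) has_integral jcoeff (\<lambda>_. 1) k s) {0..pi}" for k
      using jcoeff_integrable[OF _ assms, of "\<lambda>_. 1" k] by (simp add: jcoeff_def has_integral_integral)
    show ?thesis
      using has_integral_add[OF has_integral_mult_right[OF i[of "Suc k"], of "s + of_nat k + 1"]
          has_integral_mult_right[OF i[of k], of "s - of_nat k"]]
      by (simp only: distrib_left mult_ac)
  qed
  ultimately have "(s + of_nat k + 1) * jcoeff (\<lambda>_. 1) (Suc k) s + (s - of_nat k) * jcoeff (\<lambda>_. 1) k s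
     = 2 powr s * complex_of_real (sin (real (Suc k) * pi) - sin (real k * pi))"
    by (rule has_integral_unique[rotated])
  also have "\<dots> = 0" by (simp only: sin_npi) simp
  finally show ?thesis by (simp add: algebra_simps)
qed

text \<open>Iterate the recurrence: the factors k - s build \<open>pochhammer (-s)\<close>, and the
  divisors s + 1 + k, whose real part is positive, build \<open>pochhammer (s + 1)\<close>.\<close>

lemma jcoeff_one_eq:
  assumes "Re s > - 1 / 2"
  shows "jcoeff (\<lambda>_. 1) k s = jcoeff (\<lambda>_. 1) 0 s * (pochhammer (-s) k / pochhammer (s + 1) k)"
proof (induction k)
  case (Suc k)
  have "s + of_nat k + 1 \<noteq> 0" using assms by (auto simp: complex_eq_iff)
  then have "jcoeff (\<lambda>_. 1) (Suc k) s = (of_nat k - s) / (s + of_nat k + 1) * jcoeff (\<lambda>_. 1) k s"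
    using jcoeff_one_Suc[OF assms, of k] by (simp add: field_simps)
  then show ?case unfolding Suc.IH by (simp add: pochhammer_Suc mult_ac add_ac)
qed simp

text \<open>Put F(t) = (1 - cos t) powr (s + 1) * h (cos t). Two integrations by parts give k^2
  times the integral of F cos (k t) as minus that of F'' cos (k t), without boundary terms. Sorting
  F'' by powers of s + 1 gives three coefficients at the exponent s whose functions depend neither
  on s nor on k, so the step can be repeated.\<close>

lemma jcoeff_by_parts:
  assumes "Re s > - 1 / 2" and U: "open U" "complex_of_real ` {-1..1} \<subseteq> U" and h: "h holomorphic_on U"
  shows "of_nat k ^ 2 * jcoeff h k (s + 1) =
    - (jcoeff (\<lambda>z. (1 - z) * ((1 - z\<^sup>2) * deriv (deriv h) z - z * deriv h z)) k s
       + (s + 1) * jcoeff (\<lambda>z. - h z - 2 * (1 - z\<^sup>2) * deriv h z) k s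
       + (s + 1)\<^sup>2 * jcoeff (\<lambda>z. (1 + z) * h z) k s)"
proof -
  define q where "q = s + 1"
  have h': "deriv h holomorphic_on U" and h'': "deriv (deriv h) holomorphic_on U"
    using h U by (auto intro!: holomorphic_intros)
  have [continuous_intros]: "continuous_on (complex_of_real ` {-1..1}) h"
     "continuous_on (complex_of_real ` {-1..1}) (deriv h)"
     "continuous_on (complex_of_real ` {-1..1}) (deriv (deriv h))"
    using h h' h'' U by (auto intro!: holomorphic_on_imp_continuous_on intro: holomorphic_on_subset)
  have der: "((\<lambda>t. G (complex_of_real (cos t))) has_vector_derivative
       - of_real (sin t) * deriv G (of_real (cos t))) (at t)" if "G holomorphic_on U" for G t
  proof -
    have "(G has_field_derivative deriv G (of_real (cos t))) (at (of_real (cos t)))"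
      using that U by (intro holomorphic_derivI[of _ U]) auto
    moreover have "((\<lambda>t. complex_of_real (cos t)) has_vector_derivative of_real (- sin t)) (at t)"
      by (intro has_vector_derivative_of_real) (auto intro!: derivative_eq_intros)
    ultimately show ?thesis using field_vector_diff_chain_at[of "\<lambda>t. complex_of_real (cos t)" "of_real (- sin t)" t G] by (simp add: o_def)
  qed
  have of_real_der: "((\<lambda>t. complex_of_real (f t)) has_vector_derivative of_real f') (at t)"
    if "(f has_field_derivative f') (at t)" for f f' t
    using that by (intro has_vector_derivative_of_real) (simp add: has_real_derivative_iff_has_vector_derivative)
  let ?c = "\<lambda>t. complex_of_real (cos t)" and ?s = "\<lambda>t. complex_of_real (sin t)"
  let ?ck = "\<lambda>t. complex_of_real (cos (real k * t))" and ?sk = "\<lambda>t. complex_of_real (sin (real k * t))"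
  let ?w = "\<lambda>t. complex_of_real (1 - cos t)"
  \<comment> \<open>With F as above, the weight times \<phi> is F' cos (k t) + k F sin (k t). Its
    derivative is (F'' + k^2 F) cos (k t), the weight times \<psi>, so one antiderivative performs
    both integrations by parts.\<close>
  define \<phi> where "\<phi> = (\<lambda>t. (?s t * (q * h (?c t) - ?w t * deriv h (?c t))) * ?ck t + ?w t * h (?c t) * (of_nat k * ?sk t))"
  define \<psi> where "\<psi> = (\<lambda>t. ((1 - ?c t) * ((1 - (?c t)\<^sup>2) * deriv (deriv h) (?c t) - ?c t * deriv h (?c t))
      + q * (- h (?c t) - 2 * (1 - (?c t)\<^sup>2) * deriv h (?c t)) + q\<^sup>2 * ((1 + ?c t) * h (?c t)) + of_nat k ^ 2 * (?w t * h (?c t))) * ?ck t)"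
  have "((\<lambda>t. of_real (1 - cos t) powr s * \<psi> t) has_integral 2 powr s * \<phi> pi) {0..pi}"
  proof (rule has_integral_one_minus_cos_powr_mult[OF assms(1)])
    \<comment> \<open>The cofactor of \<open>sin (t / 2)\<close> in \<phi>, from sin t = 2 sin (t /
      2) cos (t / 2) and 1 - cos t = 2 (sin (t / 2))^2.\<close>
    show "continuous_on {0..pi} (\<lambda>t. of_real (2 * cos (t / 2)) * (q * h (?c t) - ?w t * deriv h (?c t)) * ?ck t
          + of_real (2 * sin (t / 2)) * h (?c t) * (of_nat k * ?sk t))"
      by (auto intro!: continuous_intros)
    show "\<phi> t = of_real (sin (t / 2)) * (of_real (2 * cos (t / 2)) * (q * h (?c t) - ?w t * deriv h (?c t)) * ?ck t
          + of_real (2 * sin (t / 2)) * h (?c t) * (of_nat k * ?sk t))" for t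
    proof -
      have a: "?s t = of_real (sin (t / 2)) * of_real (2 * cos (t / 2))"
        unfolding of_real_mult[symmetric] using sin_double[of "t/2"] by (simp add: mult_ac)
      have b: "?w t = of_real (sin (t / 2)) * of_real (2 * sin (t / 2))"
        unfolding of_real_mult[symmetric] using cos_double_sin[of "t/2"] by (simp add: mult_ac power2_eq_square)
      show ?thesis unfolding \<phi>_def a by (subst (2) b) (simp only: distrib_left mult_ac)
    qed
    fix t :: real
    define \<phi>' where "\<phi>' = ((?c t * (q * h (?c t) - ?w t * deriv h (?c t))
        + ?s t * (- q * ?s t * deriv h (?c t) - (?s t * deriv h (?c t) - ?w t * ?s t * deriv (deriv h) (?c t)))) * ?ck t
       - ?s t * (q * h (?c t) - ?w t * deriv h (?c t)) * (of_nat k * ?sk t)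
       + (?s t * h (?c t) - ?w t * ?s t * deriv h (?c t)) * (of_nat k * ?sk t) + ?w t * h (?c t) * (of_nat k ^ 2 * ?ck t))"
    note vd = of_real_der[of sin "cos t" t] of_real_der[of "\<lambda>t. 1 - cos t" "sin t" t]
        of_real_der[of "\<lambda>t. cos (real k * t)" "- sin (real k * t) * real k" t]
        of_real_der[of "\<lambda>t. sin (real k * t)" "cos (real k * t) * real k" t] der[OF h] der[OF h']
    show "(\<phi> has_vector_derivative \<phi>') (at t)"
      unfolding \<phi>_def \<phi>'_def
      by (rule vd derivative_intros has_vector_derivative_eq_rhs[OF has_vector_derivative_add]
           has_vector_derivative_mult has_vector_derivative_diff | (auto intro!: derivative_eq_intros; fail))+
         (simp add: algebra_simps power2_eq_square)
    have sq: "(?s t)\<^sup>2 = 1 - (?c t)\<^sup>2"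
      unfolding of_real_power[symmetric] sin_squared_eq by simp
    \<comment> \<open>With all functions abstracted to letters, the required equation holds up to a
      multiple of S^2 - (1 - C^2), which vanishes for sine and cosine.\<close>
    have ring: "s * S * ((S * (q * a - w * b)) * x + w * a * (n * y))
        + w * ((C * (q * a - w * b) + S * (- q * S * b - (S * b - w * S * d))) * x
          - S * (q * a - w * b) * (n * y) + (S * a - w * S * b) * (n * y) + w * a * (n\<^sup>2 * x))
        - w * (((1 - C) * ((1 - C\<^sup>2) * d - C * b) + q * (- a - 2 * (1 - C\<^sup>2) * b) + q\<^sup>2 * ((1 + C) * a) + n\<^sup>2 * (w * a)) * x)
      = (S\<^sup>2 - (1 - C\<^sup>2)) * ((s * (q * a - w * b) + w * (- q * b - b + w * d)) * x)"
      if "w = 1 - C" for S C a b d n x y w :: complex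
      unfolding that q_def by algebra
    have "s * ?s t * \<phi> t + ?w t * \<phi>' - ?w t * \<psi> t = 0"
      unfolding \<phi>_def \<phi>'_def \<psi>_def
      by (subst ring) (simp_all only: of_real_diff of_real_1 sq diff_self mult_zero_left)
    then show "s * ?s t * \<phi> t + ?w t * \<phi>' = ?w t * \<psi> t" by simp
  qed
  moreover have "\<phi> pi = 0" by (simp add: \<phi>_def)
  ultimately have "((\<lambda>t. of_real (1 - cos t) powr s * \<psi> t) has_integral 0) {0..pi}" by simp
  moreover have "((\<lambda>t. of_real (1 - cos t) powr s * \<psi> t) has_integral
      (jcoeff (\<lambda>z. (1 - z) * ((1 - z\<^sup>2) * deriv (deriv h) z - z * deriv h z)) k s
       + q * jcoeff (\<lambda>z. - h z - 2 * (1 - z\<^sup>2) * deriv h z) k s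
       + q\<^sup>2 * jcoeff (\<lambda>z. (1 + z) * h z) k s + of_nat k ^ 2 * jcoeff (\<lambda>z. (1 - z) * h z) k s)) {0..pi}"
  proof -
    have i: "((\<lambda>t. of_real (1 - cos t) powr s * (H (?c t) * ?ck t)) has_integral jcoeff H k s) {0..pi}"
      if "continuous_on (complex_of_real ` {-1..1}) H" for H
      unfolding jcoeff_def by (rule integrable_integral jcoeff_integrable that assms(1))+
    have "((\<lambda>t. of_real (1 - cos t) powr s * (((1 - ?c t) * ((1 - (?c t)\<^sup>2) * deriv (deriv h) (?c t) - ?c t * deriv h (?c t))) * ?ck t)
       + q * (of_real (1 - cos t) powr s * ((- h (?c t) - 2 * (1 - (?c t)\<^sup>2) * deriv h (?c t)) * ?ck t))
       + q\<^sup>2 * (of_real (1 - cos t) powr s * (((1 + ?c t) * h (?c t)) * ?ck t))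
       + of_nat k ^ 2 * (of_real (1 - cos t) powr s * (((1 - ?c t) * h (?c t)) * ?ck t))) has_integral
      (jcoeff (\<lambda>z. (1 - z) * ((1 - z\<^sup>2) * deriv (deriv h) z - z * deriv h z)) k s
       + q * jcoeff (\<lambda>z. - h z - 2 * (1 - z\<^sup>2) * deriv h z) k s
       + q\<^sup>2 * jcoeff (\<lambda>z. (1 + z) * h z) k s + of_nat k ^ 2 * jcoeff (\<lambda>z. (1 - z) * h z) k s)) {0..pi}"
      by (intro has_integral_add has_integral_mult_right i continuous_intros)
    then show ?thesis unfolding \<psi>_def by (rule has_integral_eq[rotated]) (simp add: algebra_simps)
  qed
  ultimately have "jcoeff (\<lambda>z. (1 - z) * ((1 - z\<^sup>2) * deriv (deriv h) z - z * deriv h z)) k s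
       + q * jcoeff (\<lambda>z. - h z - 2 * (1 - z\<^sup>2) * deriv h z) k s
       + q\<^sup>2 * jcoeff (\<lambda>z. (1 + z) * h z) k s + of_nat k ^ 2 * jcoeff (\<lambda>z. (1 - z) * h z) k s = 0"
    using has_integral_unique by blast
  then show ?thesis
    unfolding jcoeff_one_minus_mult q_def by (simp only: eq_neg_iff_add_eq_0 add_ac)
qed

section \<open>Uniform asymptotics in the exponent\<close>

text \<open>The growth factors 1 + K / j^2 have a product of at most exp (2 K), which bounds the
  sequence. The increments are then O(1 / j^2), and their tail sum from k on is O(1 / k). All
  constants are explicit, so they stay uniform when the sequence depends on a parameter.\<close>

lemma slowly_varying_sequence_limit_bound:
  fixes a :: "nat \<Rightarrow> complex"
  assumes step: "\<And>k. k \<ge> 1 \<Longrightarrow> norm (a (Suc k) - a k) \<le> K / real k ^ 2 * norm (a k)"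
    and init: "norm (a 1) \<le> A" and K: "K \<ge> 0" and lim: "a \<longlonglongrightarrow> l" and k: "k \<ge> 1"
  shows "norm (a k) \<le> A * exp (2 * K)" "norm (a k - l) \<le> 2 * K * (A * exp (2 * K)) / real k"
proof -
  define C where "C = A * exp (2 * K)"
  have A: "A \<ge> 0" using init norm_ge_zero order_trans by blast
  \<comment> \<open>A telescoping majorant: the right side is 2 / (j (j + 1)).\<close>
  have sq: "1 / real j ^ 2 \<le> 2 / real j - 2 / real (Suc j)" if "j \<ge> 1" for j
    using that by (simp add: divide_simps power2_eq_square)
  \<comment> \<open>The exponent is the partial sum of the telescoping majorant; it is 0 at k = 1,
    where the bound is just \<open>A\<close>.\<close>
  have b: "norm (a k) \<le> A * exp (K * (2 - 2 / real k))" if "k \<ge> 1" for k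
    using that
  proof (induction k rule: dec_induct)
    case base
    then show ?case using init by simp
  next
    case (step j)
    have "norm (a (Suc j)) \<le> norm (a (Suc j) - a j) + norm (a j)"
      using norm_triangle_sub[of "a (Suc j)" "a j"] by simp
    also have "\<dots> \<le> (1 + K / real j ^ 2) * norm (a j)"
      using assms(1)[OF step(1)] by (simp add: algebra_simps)
    also have "\<dots> \<le> exp (K / real j ^ 2) * norm (a j)"
      by (intro mult_right_mono exp_ge_add_one_self) auto
    also have "\<dots> \<le> exp (K / real j ^ 2) * (A * exp (K * (2 - 2 / real j)))"
      using step.IH by (intro mult_left_mono) auto
    also have "\<dots> = A * exp (K * (1 / real j ^ 2 + (2 - 2 / real j)))"
      by (simp add: distrib_left exp_add mult_ac)
    also have "\<dots> \<le> A * exp (K * (2 - 2 / real (Suc j)))"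
      using sq[OF step(1)] A K by (intro mult_left_mono) (auto intro!: mult_left_mono)
    finally show ?case .
  qed
  have C: "norm (a k) \<le> C" if "k \<ge> 1" for k
  proof -
    have "A * exp (K * (2 - 2 / real k)) \<le> C" unfolding C_def
      using A K mult_left_mono[of "2 - 2 / real k" 2 K] by (intro mult_left_mono) (auto simp: mult.commute)
    then show ?thesis using b[OF that] by linarith
  qed
  then show "norm (a k) \<le> A * exp (2 * K)" using k by (simp add: C_def)
  have tele: "norm (a k - a m) \<le> K * C * (2 / real k - 2 / real m)" if "m \<ge> k" for m
    using that
  proof (induction m rule: dec_induct)
    case (step j)
    have "norm (a k - a (Suc j)) \<le> norm (a k - a j) + norm (a (Suc j) - a j)"
      by (smt (verit) norm_minus_commute norm_triangle_ineq4 diff_diff_eq2 add_diff_cancel norm_triangle_sub diff_add_cancel diff_diff_add)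
    also have "norm (a (Suc j) - a j) \<le> K / real j ^ 2 * C"
      using assms(1)[of j] C[of j] k step K by (intro order_trans[OF assms(1)] mult_left_mono) auto
    also have "\<dots> = K * C * (1 / real j ^ 2)" by simp
    also have "\<dots> \<le> K * C * (2 / real j - 2 / real (Suc j))"
      using sq[of j] k step K A by (intro mult_left_mono) (auto simp: C_def)
    finally show ?case using step.IH by (simp add: algebra_simps)
  qed simp
  have "(\<lambda>m. norm (a k - a m)) \<longlonglongrightarrow> norm (a k - l)"
    by (intro tendsto_intros lim)
  moreover have "\<forall>\<^sub>F m in sequentially. norm (a k - a m) \<le> 2 * K * C / real k"
    using eventually_ge_at_top[of k]
  proof eventually_elim
    case (elim m)
    have "K * C * (2 / real k - 2 / real m) \<le> K * C * (2 / real k)"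
      using K A by (intro mult_left_mono) (auto simp: C_def)
    then show ?case using tele[OF elim] by simp
  qed
  ultimately show "norm (a k - l) \<le> 2 * K * (A * exp (2 * K)) / real k"
    unfolding C_def by (rule tendsto_upperbound) simp
qed

text \<open>First-order expansion of (1 + u) powr w, uniform in w. One error term comes from the
  exponential series at w ln (1 + u), the other from replacing ln (1 + u) by u.\<close>

lemma exp_mult_ln_one_plus_bound:
  fixes w :: complex and u :: real
  assumes u: "0 \<le> u" "u \<le> 1" and w: "norm w \<le> W"
  shows "norm (exp (w * of_real (ln (1 + u))) - (1 + w * of_real u)) \<le> (exp W * W\<^sup>2 + W) * u\<^sup>2"
proof -
  define L where "L = ln (1 + u)"
  have L: "0 \<le> L" "L \<le> u" "\<bar>L - u\<bar> \<le> u\<^sup>2"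
    using abs_ln_one_plus_x_minus_x_bound_nonneg[OF u] ln_add_one_self_le_self[OF u(1)] u by (auto simp: L_def)
  have W: "W \<ge> 0" using w norm_ge_zero order_trans by blast
  have nwL: "norm (w * of_real L) \<le> W * u" using L w u W by (auto simp: norm_mult intro!: mult_mono)
  also have "W * u \<le> W * 1" using u W by (intro mult_left_mono)
  finally have nwL1: "norm (w * of_real L) \<le> W" by simp
  have "norm (exp (w * of_real L) - (1 + w * of_real L)) \<le> exp \<bar>Re (w * of_real L)\<bar> * norm (w * of_real L) ^ 2"
    using Taylor_exp[of "w * of_real L" 1] by (simp add: numeral_2_eq_2)
  also have "\<dots> \<le> exp W * (W * u) ^ 2"
    using nwL nwL1 abs_Re_le_cmod[of "w * of_real L"] by (intro mult_mono power_mono) auto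
  finally have 1: "norm (exp (w * of_real L) - (1 + w * of_real L)) \<le> exp W * W\<^sup>2 * u\<^sup>2"
    by (simp add: power_mult_distrib)
  have "norm (w * of_real L - w * of_real u) = norm w * \<bar>L - u\<bar>"
    by (simp flip: right_diff_distrib of_real_diff add: norm_mult)
  also have "\<dots> \<le> W * u\<^sup>2" using w L W by (intro mult_mono) auto
  finally have "norm (w * of_real L - w * of_real u) \<le> W * u\<^sup>2" .
  with 1 have "norm ((exp (w * of_real L) - (1 + w * of_real L)) + (w * of_real L - w * of_real u)) \<le> exp W * W\<^sup>2 * u\<^sup>2 + W * u\<^sup>2"
    by (intro order_trans[OF norm_triangle_ineq] add_mono)
  then show ?thesis unfolding L_def by (simp add: algebra_simps)
qed

text \<open>Divide the two Gauss product formulas for the reciprocal Gamma function at -s and s + 1: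
  the factorials cancel and the exponentials combine to the power 2 s + 1 of k.\<close>

lemma pochhammer_quotient_tendsto:
  fixes s :: complex
  assumes s: "Re s > - 1"
  shows "(\<lambda>k. of_nat k powr (2 * s + 1) * (pochhammer (-s) k / pochhammer (s + 1) k)) \<longlonglongrightarrow> rGamma (-s) * Gamma (s + 1)"
proof -
  have nz: "s + 1 \<notin> \<int>\<^sub>\<le>\<^sub>0"
    using s by (auto elim!: nonpos_Ints_cases simp: complex_eq_iff)
  then have rnz: "rGamma (s + 1) \<noteq> 0" by (simp add: rGamma_eq_zero_iff)
  have "(\<lambda>n. rGamma_series (-s) n / rGamma_series (s + 1) n) \<longlonglongrightarrow> rGamma (-s) / rGamma (s + 1)"
    by (intro tendsto_intros rnz)
  \<comment> \<open>\<open>rGamma_series\<close> uses Pochhammer symbols of length n + 1. The factor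
    (n + s + 1) / (n - s), written as 1 plus a null sequence, strips the last factor from
    each.\<close>
  moreover have "(\<lambda>n. 1 + (2 * s + 1) / (of_nat n - s)) \<longlonglongrightarrow> 1 + 0"
  proof (intro tendsto_add tendsto_const tendsto_divide_0[OF tendsto_const])
    show "filterlim (\<lambda>n. of_nat n - s) at_infinity sequentially"
      using tendsto_add_filterlim_at_infinity[OF tendsto_const[of "- s"] tendsto_of_nat] by simp
  qed
  ultimately have "(\<lambda>n. rGamma_series (-s) n / rGamma_series (s + 1) n * (1 + (2 * s + 1) / (of_nat n - s))) \<longlonglongrightarrow> rGamma (-s) / rGamma (s + 1) * (1 + 0)"
    by (rule tendsto_mult)
  moreover have "\<forall>\<^sub>F n in sequentially. rGamma_series (-s) n / rGamma_series (s + 1) n * (1 + (2 * s + 1) / (of_nat n - s))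
     = of_nat n powr (2 * s + 1) * (pochhammer (-s) n / pochhammer (s + 1) n)"
    \<comment> \<open>Beyond this index n exceeds the modulus of s, so n - s is not 0.\<close>
    using eventually_gt_at_top[of "max 1 (nat \<lceil>norm s\<rceil>)"]
  proof eventually_elim
    case (elim n)
    then have n: "n > 0" and "real n > norm s" by linarith+
    then have d: "of_nat n - s \<noteq> 0" by auto
    have p: "pochhammer (s + 1) n \<noteq> 0" "s + 1 + of_nat n \<noteq> 0"
      using nz pochhammer_eq_0_imp_nonpos_Int apply blast
      using s by (auto simp: complex_eq_iff)
    have e: "exp ((s + 1) * of_real (ln (real n))) = of_nat n powr (2 * s + 1) * exp (- s * of_real (ln (real n)))"
      using n by (simp add: powr_def Ln_of_nat exp_add[symmetric] algebra_simps)
    show ?case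
      using n d p unfolding rGamma_series_def e Suc_eq_plus1[symmetric] pochhammer_Suc
      by (simp add: divide_simps)
  qed
  ultimately have "(\<lambda>k. of_nat k powr (2 * s + 1) * (pochhammer (-s) k / pochhammer (s + 1) k)) \<longlonglongrightarrow> rGamma (-s) / rGamma (s + 1) * (1 + 0)"
    by (rule Lim_transform_eventually)
  then show ?thesis by (simp add: Gamma_def divide_inverse)
qed

text \<open>Consecutive terms have the quotient (1 + 1/k) powr (2 s + 1) * (1 - s/k) / (1 + (s +
  1)/k). Its terms of order 1/k cancel because (2 s + 1) - s - (s + 1) = 0, so it is 1 + O(1/k^2)
  uniformly in s, and \<open>slowly_varying_sequence_limit_bound\<close> upgrades the pointwise
  limit to a uniform rate.\<close>

lemma pochhammer_quotient_uniform:
  fixes \<sigma> B :: real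
  assumes \<sigma>: "\<sigma> > - 1 / 2" and B: "B \<ge> 0"
  obtains M where "M > 0"
    "\<And>k s. k \<ge> 1 \<Longrightarrow> \<sigma> \<le> Re s \<Longrightarrow> norm s \<le> B \<Longrightarrow>
       norm (of_nat k powr (2 * s + 1) * (pochhammer (-s) k / pochhammer (s + 1) k)) \<le> M"
    "\<And>k s. k \<ge> 1 \<Longrightarrow> \<sigma> \<le> Re s \<Longrightarrow> norm s \<le> B \<Longrightarrow>
       norm (of_nat k powr (2 * s + 1) * (pochhammer (-s) k / pochhammer (s + 1) k)
             - rGamma (-s) * Gamma (s + 1)) \<le> M / real k"
proof -
  define W where "W = 2 * B + 1"
  \<comment> \<open>The first summand bounds the expansion error of the power times 1 - s/k, the
    second the leftover product (2 s + 1) s.\<close>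
  define K where "K = (exp W * W\<^sup>2 + W) * (1 + B) + W * B"
  have W: "W \<ge> 0" using B by (simp add: W_def)
  have K: "K \<ge> 0" using B W by (simp add: K_def)
  define P where "P = (\<lambda>s k. of_nat k powr (2 * s + 1) * (pochhammer (-s) k / pochhammer (s + 1) k) :: complex)"
  have st: "norm (P s (Suc k) - P s k) \<le> K / real k ^ 2 * norm (P s k)"
    if k: "k \<ge> 1" and s: "\<sigma> \<le> Re s" "norm s \<le> B" for s k
  proof -
    define u where "u = 1 / real k"
    define E where "E = exp ((2 * s + 1) * of_real (ln (1 + u)))"
    have u: "0 \<le> u" "u \<le> 1" using k by (auto simp: u_def)
    have nw: "norm (2 * s + 1) \<le> W"
      using norm_triangle_ineq[of "2 * s" 1] s by (simp add: W_def norm_mult)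
    have den: "1 \<le> norm (1 + (s + 1) * of_real u)"
    proof -
      have "1 \<le> Re (1 + (s + 1) * of_real u)" using s \<sigma> u by simp
      then show ?thesis using complex_Re_le_cmod order_trans by blast
    qed
    have kn: "complex_of_nat k \<noteq> 0" using k by simp
    have ku: "of_nat k * complex_of_real u = 1" using kn by (simp add: u_def)
    have Pk: "of_nat (Suc k) powr (2 * s + 1) = E * of_nat k powr (2 * s + 1)"
    proof -
      have "real (Suc k) = (1 + u) * real k" using k by (simp add: u_def field_simps)
      then have "ln (real (Suc k)) = ln (1 + u) + ln (real k)" using k u by (simp add: ln_mult)
      then show ?thesis using k
        unfolding E_def powr_def by (simp add: Ln_of_nat exp_add[symmetric] algebra_simps del: of_nat_Suc)
    qed
    have q: "(of_nat k - s) / (s + 1 + of_nat k) = (1 - s * of_real u) / (1 + (s + 1) * of_real u)"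
    proof -
      have "(of_nat k - s) / (s + 1 + of_nat k) = (of_nat k * (1 - s * of_real u)) / (of_nat k * (1 + (s + 1) * of_real u))"
        using ku by (simp add: right_diff_distrib distrib_left mult.left_commute[of "of_nat k"] add_ac)
      then show ?thesis using kn by simp
    qed
    have "P s (Suc k) = E * ((of_nat k - s) / (s + 1 + of_nat k)) * P s k"
      unfolding P_def Pk by (simp add: pochhammer_Suc mult_ac)
    also have "\<dots> = E * ((1 - s * of_real u) / (1 + (s + 1) * of_real u)) * P s k" by (simp only: q)
    finally have "P s (Suc k) - P s k = (E * ((1 - s * of_real u) / (1 + (s + 1) * of_real u)) - 1) * P s k"
      by (simp add: algebra_simps)
    \<comment> \<open>Here the first-order terms cancel: (1 + (2 s + 1) u) (1 - s u) = 1 + (s + 1) u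
      - (2 s + 1) s u^2.\<close>
    moreover have "E * ((1 - s * of_real u) / (1 + (s + 1) * of_real u)) - 1
      = ((E - (1 + (2 * s + 1) * of_real u)) * (1 - s * of_real u) - (2 * s + 1) * s * of_real (u\<^sup>2)) / (1 + (s + 1) * of_real u)"
    proof -
      have dn: "1 + (s + 1) * of_real u \<noteq> 0" using den by auto
      have "E * (1 - s * of_real u) - (1 + (s + 1) * of_real u)
         = (E - (1 + (2 * s + 1) * of_real u)) * (1 - s * of_real u) - (2 * s + 1) * s * of_real (u\<^sup>2)"
        by (simp add: algebra_simps power2_eq_square)
      moreover have "E * ((1 - s * of_real u) / (1 + (s + 1) * of_real u)) - 1
         = (E * (1 - s * of_real u) - (1 + (s + 1) * of_real u)) / (1 + (s + 1) * of_real u)"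
      proof -
        have "E * (n / d) - 1 = (E * n - d) / d" if "d \<noteq> 0" for n d :: complex
          using that by (simp add: field_simps)
        then show ?thesis using dn by blast
      qed
      ultimately show ?thesis by (simp only:)
    qed
    moreover have "norm \<dots> \<le> K * u\<^sup>2"
    proof -
      have "norm ((E - (1 + (2 * s + 1) * of_real u)) * (1 - s * of_real u)) \<le> ((exp W * W\<^sup>2 + W) * u\<^sup>2) * (1 + B)"
      proof -
        have "norm (1 - s * of_real u) \<le> 1 + norm s * u"
          using norm_triangle_ineq4[of 1 "s * of_real u"] u by (simp add: norm_mult)
        also have "norm s * u \<le> B * 1" using u s B by (intro mult_mono) auto
        finally have "norm (1 - s * of_real u) \<le> 1 + B" by simp
        then show ?thesis
          using exp_mult_ln_one_plus_bound[OF u nw] W B unfolding norm_mult E_def by (intro mult_mono) auto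
      qed
      moreover have "norm ((2 * s + 1) * s * of_real (u\<^sup>2)) \<le> W * B * u\<^sup>2"
        using nw s W B by (auto simp: norm_mult norm_power intro!: mult_mono)
      ultimately have num: "norm ((E - (1 + (2 * s + 1) * of_real u)) * (1 - s * of_real u) - (2 * s + 1) * s * of_real (u\<^sup>2)) \<le> K * u\<^sup>2"
        using norm_triangle_ineq4[of "(E - (1 + (2 * s + 1) * of_real u)) * (1 - s * of_real u)" "(2 * s + 1) * s * of_real (u\<^sup>2)"]
        by (simp add: K_def algebra_simps)
      show ?thesis
        unfolding norm_divide using den num by (intro order_trans[OF divide_left_mono[OF den]]) auto
    qed
    ultimately have "norm (P s (Suc k) - P s k) \<le> K * u\<^sup>2 * norm (P s k)"
      by (metis mult_right_mono norm_ge_zero norm_mult)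
    then show ?thesis by (simp add: u_def power_divide)
  qed
  \<comment> \<open>The first term is -s / (s + 1), and the denominator has modulus at least
    1/2.\<close>
  have init: "norm (P s 1) \<le> 2 * B" if s: "\<sigma> \<le> Re s" "norm s \<le> B" for s
  proof -
    have "1 / 2 \<le> norm (s + 1)" using s \<sigma> complex_Re_le_cmod[of "s + 1"] by simp
    then have "norm s / norm (s + 1) \<le> B / (1 / 2)" using s B by (intro frac_le) auto
    then show ?thesis by (simp add: P_def norm_divide)
  qed
  have lim: "P s \<longlonglongrightarrow> rGamma (-s) * Gamma (s + 1)" if "\<sigma> \<le> Re s" for s
    unfolding P_def using that \<sigma> by (intro pochhammer_quotient_tendsto) auto
  define M where "M = 2 * B * exp (2 * K) + 2 * K * (2 * B * exp (2 * K)) + 1"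
  have pos: "2 * B * exp (2 * K) \<ge> 0" "2 * K * (2 * B * exp (2 * K)) \<ge> 0" using B K by auto
  show ?thesis
  proof (rule that[of M])
    show "M > 0" using pos unfolding M_def by linarith
    fix k :: nat and s :: complex assume k: "k \<ge> 1" and s: "\<sigma> \<le> Re s" "norm s \<le> B"
    note b = slowly_varying_sequence_limit_bound[OF st[OF _ s] init[OF s] K lim[OF s(1)] k]
    show "norm (of_nat k powr (2 * s + 1) * (pochhammer (-s) k / pochhammer (s + 1) k)) \<le> M"
      using b(1) pos unfolding P_def M_def by linarith
    have "2 * K * (2 * B * exp (2 * K)) / real k \<le> M / real k"
      using pos unfolding M_def by (intro divide_right_mono) linarith+
    then show "norm (of_nat k powr (2 * s + 1) * (pochhammer (-s) k / pochhammer (s + 1) k)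
             - rGamma (-s) * Gamma (s + 1)) \<le> M / real k"
      using b(2) by (simp add: P_def)
  qed
qed

section \<open>Decay and leading term for a general analytic factor\<close>

text \<open>Write H(z) = H(1) + (1 - z) h(z). The factor 1 - z raises the exponent to s + 1, where
  \<open>jcoeff_by_parts\<close> gains k^(-2). The three new functions are fixed before k and s,
  which is what uniform estimates need.\<close>

lemma jcoeff_split_at_one:
  assumes U: "open U" "complex_of_real ` {-1..1} \<subseteq> U" and H: "H holomorphic_on U"
  obtains H1 H2 H3 where "H1 holomorphic_on U" "H2 holomorphic_on U" "H3 holomorphic_on U"
    "\<And>k s. k \<ge> 1 \<Longrightarrow> Re s > - 1 / 2 \<Longrightarrow> jcoeff H k s = H 1 * jcoeff (\<lambda>_. 1) k s
       - (jcoeff H1 k s + (s + 1) * jcoeff H2 k s + (s + 1)\<^sup>2 * jcoeff H3 k s) / of_nat k ^ 2"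
proof -
  \<comment> \<open>Minus the difference quotient of \<open>H\<close> at 1, with the removable
    singularity filled in.\<close>
  define h where "h = (\<lambda>z. - (if z = 1 then deriv H 1 else (H z - H 1) / (z - 1)))"
  have "1 \<in> U" using U(2) by force
  then have h: "h holomorphic_on U"
    unfolding h_def using U by (intro holomorphic_on_minus pole_lemma H) (simp add: interior_open)
  have h': "deriv h holomorphic_on U" and h'': "deriv (deriv h) holomorphic_on U"
    using h U by (auto intro!: holomorphic_intros)
  have eq: "H z = H 1 * 1 + (1 - z) * h z" for z
    by (simp add: h_def field_simps)
  have cont: "continuous_on (complex_of_real ` {-1..1}) h"
    using h U by (meson holomorphic_on_imp_continuous_on continuous_on_subset)
  show ?thesis
  proof (rule that)
    show "(\<lambda>z. (1 - z) * ((1 - z\<^sup>2) * deriv (deriv h) z - z * deriv h z)) holomorphic_on U"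
         "(\<lambda>z. - h z - 2 * (1 - z\<^sup>2) * deriv h z) holomorphic_on U" "(\<lambda>z. (1 + z) * h z) holomorphic_on U"
      using h h' h'' by (auto intro!: holomorphic_intros)
    fix k :: nat and s :: complex assume k: "k \<ge> 1" and s: "Re s > - 1 / 2"
    have "jcoeff H k s = jcoeff (\<lambda>z. H 1 * 1 + (1 - z) * h z) k s"
      using eq by (intro jcoeff_cong) blast
    also have "\<dots> = jcoeff (\<lambda>z. H 1 * 1) k s + jcoeff (\<lambda>z. (1 - z) * h z) k s"
      by (intro jcoeff_add s continuous_intros cont)
    also have "\<dots> = H 1 * jcoeff (\<lambda>_. 1) k s + jcoeff h k (s + 1)"
      by (simp only: jcoeff_cmult jcoeff_one_minus_mult)
    also have "jcoeff h k (s + 1) = of_nat k ^ 2 * jcoeff h k (s + 1) / of_nat k ^ 2"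
      using k by simp
    finally show "jcoeff H k s = H 1 * jcoeff (\<lambda>_. 1) k s
       - (jcoeff (\<lambda>z. (1 - z) * ((1 - z\<^sup>2) * deriv (deriv h) z - z * deriv h z)) k s
          + (s + 1) * jcoeff (\<lambda>z. - h z - 2 * (1 - z\<^sup>2) * deriv h z) k s
          + (s + 1)\<^sup>2 * jcoeff (\<lambda>z. (1 + z) * h z) k s) / of_nat k ^ 2"
      unfolding jcoeff_by_parts[OF s U h] by (simp only: minus_divide_left[symmetric] add_uminus_conv_diff)
  qed
qed

lemma norm_nat_powr: "k \<ge> 1 \<Longrightarrow> norm (of_nat k powr z :: complex) = real k powr Re z"
  by (subst norm_powr_real_powr) auto

text \<open>Induction on m: each splitting at 1 leaves a pure power, of order
  \<open>k powr (- 2 * Re s - 1)\<close>, and a remainder divided by k^2. The crude second term thus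
  improves by two orders per step.\<close>

lemma jcoeff_decay:
  fixes \<sigma> B :: real
  assumes \<sigma>: "\<sigma> > - 1 / 2" and B: "B \<ge> 0"
    and U: "open U" "complex_of_real ` {-1..1} \<subseteq> U" and H: "H holomorphic_on U"
  shows "\<exists>M>0. \<forall>k s. k \<ge> 1 \<longrightarrow> \<sigma> \<le> Re s \<longrightarrow> norm s \<le> B \<longrightarrow>
           norm (jcoeff H k s) \<le> M * (real k powr (- 2 * Re s - 1) + 1 / real k ^ (2 * m))"
  using H
proof (induction m arbitrary: H)
  case 0
  have "continuous_on (complex_of_real ` {-1..1}) H"
    using 0 U by (meson holomorphic_on_imp_continuous_on continuous_on_subset)
  then obtain M where M: "M > 0" "\<And>k s. \<sigma> \<le> Re s \<Longrightarrow> norm s \<le> B \<Longrightarrow> norm (jcoeff H k s) \<le> M"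
    using jcoeff_bounded[OF \<sigma>] by blast
  show ?case
  proof (intro exI[of _ M] conjI allI impI M(1))
    fix k :: nat and s :: complex assume "k \<ge> 1" "\<sigma> \<le> Re s" "norm s \<le> B"
    moreover have "M * 1 \<le> M * (real k powr (- 2 * Re s - 1) + 1 / real k ^ (2 * 0))"
      using M(1) by (intro mult_left_mono) auto
    ultimately show "norm (jcoeff H k s) \<le> M * (real k powr (- 2 * Re s - 1) + 1 / real k ^ (2 * 0))"
      using M(2)[of s k] by linarith
  qed
next
  case (Suc m)
  obtain H1 H2 H3 where Hi: "H1 holomorphic_on U" "H2 holomorphic_on U" "H3 holomorphic_on U"
    and split: "\<And>k s. k \<ge> 1 \<Longrightarrow> Re s > - 1 / 2 \<Longrightarrow> jcoeff H k s = H 1 * jcoeff (\<lambda>_. 1) k s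
       - (jcoeff H1 k s + (s + 1) * jcoeff H2 k s + (s + 1)\<^sup>2 * jcoeff H3 k s) / of_nat k ^ 2"
    using jcoeff_split_at_one[OF U Suc.prems] by blast
  obtain M1 where M1: "M1 > 0" "\<And>k s. k \<ge> 1 \<Longrightarrow> \<sigma> \<le> Re s \<Longrightarrow> norm s \<le> B \<Longrightarrow>
           norm (jcoeff H1 k s) \<le> M1 * (real k powr (- 2 * Re s - 1) + 1 / real k ^ (2 * m))"
    using Suc.IH[OF Hi(1)] by blast
  obtain M2 where M2: "M2 > 0" "\<And>k s. k \<ge> 1 \<Longrightarrow> \<sigma> \<le> Re s \<Longrightarrow> norm s \<le> B \<Longrightarrow>
           norm (jcoeff H2 k s) \<le> M2 * (real k powr (- 2 * Re s - 1) + 1 / real k ^ (2 * m))"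
    using Suc.IH[OF Hi(2)] by blast
  obtain M3 where M3: "M3 > 0" "\<And>k s. k \<ge> 1 \<Longrightarrow> \<sigma> \<le> Re s \<Longrightarrow> norm s \<le> B \<Longrightarrow>
           norm (jcoeff H3 k s) \<le> M3 * (real k powr (- 2 * Re s - 1) + 1 / real k ^ (2 * m))"
    using Suc.IH[OF Hi(3)] by blast
  obtain P where P: "P > 0" "\<And>k s. k \<ge> 1 \<Longrightarrow> \<sigma> \<le> Re s \<Longrightarrow> norm s \<le> B \<Longrightarrow>
       norm (of_nat k powr (2 * s + 1) * (pochhammer (-s) k / pochhammer (s + 1) k)) \<le> P"
    using pochhammer_quotient_uniform[OF \<sigma> B] by metis
  obtain J where J: "J > 0" "\<And>k s. \<sigma> \<le> Re s \<Longrightarrow> norm s \<le> B \<Longrightarrow> norm (jcoeff (\<lambda>_. 1) k s) \<le> J"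
    using jcoeff_bounded[OF \<sigma>, of "\<lambda>_. 1"] by (metis continuous_on_const)
  define N where "N = M1 + (B + 1) * M2 + (B + 1)\<^sup>2 * M3"
  have N: "N > 0" using M1(1) M2(1) M3(1) B by (auto simp: N_def intro!: add_pos_nonneg mult_nonneg_nonneg)
  define M where "M = norm (H 1) * (J * P) + N"
  have M: "M > 0" "norm (H 1) * (J * P) \<ge> 0" using N J(1) P(1) by (auto simp: M_def intro!: add_nonneg_pos)
  show ?case
  proof (intro exI[of _ M] conjI allI impI M)
    fix k :: nat and s :: complex assume k: "k \<ge> 1" and s: "\<sigma> \<le> Re s" "norm s \<le> B"
    define X where "X = real k powr (- 2 * Re s - 1)"
    define Y where "Y = 1 / real k ^ (2 * m)"
    have XY: "X \<ge> 0" "Y \<ge> 0" by (auto simp: X_def Y_def)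
    have s1: "norm (s + 1) \<le> B + 1" using s norm_triangle_ineq[of s 1] by simp
    \<comment> \<open>\<open>X\<close> is the reciprocal of the modulus of
      \<open>k powr (2 * s + 1)\<close>, so the bound on the scaled Pochhammer quotient becomes a
      bound of order \<open>X\<close>.\<close>
    have A: "norm (jcoeff (\<lambda>_. 1) k s) \<le> J * P * X"
    proof -
      have "norm (pochhammer (-s) k / pochhammer (s + 1) k) = 
        norm (of_nat k powr (2 * s + 1) * (pochhammer (-s) k / pochhammer (s + 1) k)) * X"
      proof -
        have "norm (of_nat k powr (2 * s + 1) :: complex) * X = 1"
          using k unfolding X_def norm_nat_powr[OF k] by (simp add: powr_add[symmetric])
        then show ?thesis by (simp only: norm_mult mult_ac) (simp add: mult.assoc[symmetric] mult.commute)
      qed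
      also have "\<dots> \<le> P * X" using P(2)[OF k s] XY by (intro mult_right_mono)
      finally show ?thesis
        using J(2)[OF s, of 0] J(1)
        unfolding jcoeff_one_eq[OF less_le_trans[OF \<sigma> s(1)], of k] norm_mult mult.assoc
        by (intro mult_mono) auto
    qed
    have "norm (jcoeff H1 k s + (s + 1) * jcoeff H2 k s + (s + 1)\<^sup>2 * jcoeff H3 k s)
       \<le> M1 * (X + Y) + (B + 1) * (M2 * (X + Y)) + (B + 1)\<^sup>2 * (M3 * (X + Y))"
      using M1(2)[OF k s] M2(2)[OF k s] M3(2)[OF k s] s1 B unfolding X_def[symmetric] Y_def[symmetric]
      by (intro order_trans[OF norm_triangle_ineq] add_mono) (auto simp: norm_mult norm_power intro!: mult_mono power_mono)
    then have B': "norm (jcoeff H1 k s + (s + 1) * jcoeff H2 k s + (s + 1)\<^sup>2 * jcoeff H3 k s) \<le> N * (X + Y)"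
      by (simp add: N_def algebra_simps)
    have k2: "1 \<le> real k ^ 2" using k by simp
    have "norm (jcoeff H k s) \<le> norm (H 1 * jcoeff (\<lambda>_. 1) k s)
       + norm ((jcoeff H1 k s + (s + 1) * jcoeff H2 k s + (s + 1)\<^sup>2 * jcoeff H3 k s) / of_nat k ^ 2)"
      unfolding split[OF k less_le_trans[OF \<sigma> s(1)]] by (rule norm_triangle_ineq4)
    also have "\<dots> \<le> norm (H 1) * (J * P * X) + N * (X + Y) / real k ^ 2"
      using A B' by (intro add_mono) (auto simp: norm_mult norm_divide norm_power intro!: mult_left_mono divide_right_mono)
    also have "N * (X + Y) / real k ^ 2 \<le> N * (X + Y / real k ^ 2)"
    proof -
      have "X / real k ^ 2 \<le> X / 1" using k k2 XY by (intro divide_left_mono) auto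
      then have "N * ((X + Y) / real k ^ 2) \<le> N * (X + Y / real k ^ 2)"
        using N by (intro mult_left_mono) (auto simp: add_divide_distrib)
      then show ?thesis by simp
    qed
    also have "norm (H 1) * (J * P * X) + N * (X + Y / real k ^ 2) \<le> M * (X + Y / real k ^ 2)"
    proof -
      have "norm (H 1) * (J * P) * X \<le> norm (H 1) * (J * P) * (X + Y / real k ^ 2)"
        using XY by (intro mult_left_mono M(2)) auto
      then show ?thesis by (simp add: M_def algebra_simps)
    qed
    also have "Y / real k ^ 2 = 1 / real k ^ (2 * Suc m)"
      by (simp add: Y_def power_add[symmetric] algebra_simps)
    finally show "norm (jcoeff H k s) \<le> M * (real k powr (- 2 * Re s - 1) + 1 / real k ^ (2 * Suc m))"
      by (simp add: X_def)
  qed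
qed

text \<open>The limit of \<open>k powr (2 s + 1) * jcoeff (\<lambda>_. 1) k s\<close>; on the real axis it is \<open>pi / 2\<close> times the
  leading coefficient \<open>A(s)\<close> of \<open>(1 - x)\<^sup>s\<close>.\<close>
definition lead_fun :: "complex \<Rightarrow> complex" where
  "lead_fun s = jcoeff (\<lambda>_. 1) 0 s * (rGamma (-s) * Gamma (s + 1))"

text \<open>Split at 1 once more. The pure power yields the limit with error O(1/k) by
  \<open>pochhammer_quotient_uniform\<close>; the remainder carries k^(-2), and
  \<open>jcoeff_decay\<close> keeps its scaled coefficients bounded.\<close>

lemma jcoeff_asymp_uniform:
  fixes \<sigma> B :: real
  assumes \<sigma>: "\<sigma> > - 1 / 2" and B: "B \<ge> 0"
    and U: "open U" "complex_of_real ` {-1..1} \<subseteq> U" and H: "H holomorphic_on U"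
  obtains M where "M > 0" "\<And>k s. k \<ge> 1 \<Longrightarrow> \<sigma> \<le> Re s \<Longrightarrow> norm s \<le> B \<Longrightarrow>
           norm (of_nat k powr (2 * s + 1) * jcoeff H k s - H 1 * lead_fun s) \<le> M / real k"
proof -
  obtain H1 H2 H3 where Hi: "H1 holomorphic_on U" "H2 holomorphic_on U" "H3 holomorphic_on U"
    and split: "\<And>k s. k \<ge> 1 \<Longrightarrow> Re s > - 1 / 2 \<Longrightarrow> jcoeff H k s = H 1 * jcoeff (\<lambda>_. 1) k s
       - (jcoeff H1 k s + (s + 1) * jcoeff H2 k s + (s + 1)\<^sup>2 * jcoeff H3 k s) / of_nat k ^ 2"
    using jcoeff_split_at_one[OF U H] by blast
  \<comment> \<open>Large enough that 2 m \<ge> 2 B + 1 \<ge> 2 Re s + 1, so scaling by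
    \<open>k powr (2 * s + 1)\<close> does not make the term \<open>1 / real k ^ (2 * m)\<close>
    grow.\<close>
  define m where "m = Suc (nat \<lceil>B\<rceil>)"
  have m: "2 * B + 1 \<le> real (2 * m)" unfolding m_def by simp linarith
  obtain M1 where M1: "M1 > 0" "\<And>k s. k \<ge> 1 \<Longrightarrow> \<sigma> \<le> Re s \<Longrightarrow> norm s \<le> B \<Longrightarrow>
           norm (jcoeff H1 k s) \<le> M1 * (real k powr (- 2 * Re s - 1) + 1 / real k ^ (2 * m))"
    using jcoeff_decay[OF \<sigma> B U Hi(1)] by blast
  obtain M2 where M2: "M2 > 0" "\<And>k s. k \<ge> 1 \<Longrightarrow> \<sigma> \<le> Re s \<Longrightarrow> norm s \<le> B \<Longrightarrow>
           norm (jcoeff H2 k s) \<le> M2 * (real k powr (- 2 * Re s - 1) + 1 / real k ^ (2 * m))"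
    using jcoeff_decay[OF \<sigma> B U Hi(2)] by blast
  obtain M3 where M3: "M3 > 0" "\<And>k s. k \<ge> 1 \<Longrightarrow> \<sigma> \<le> Re s \<Longrightarrow> norm s \<le> B \<Longrightarrow>
           norm (jcoeff H3 k s) \<le> M3 * (real k powr (- 2 * Re s - 1) + 1 / real k ^ (2 * m))"
    using jcoeff_decay[OF \<sigma> B U Hi(3)] by blast
  obtain P where P: "P > 0" "\<And>k s. k \<ge> 1 \<Longrightarrow> \<sigma> \<le> Re s \<Longrightarrow> norm s \<le> B \<Longrightarrow>
       norm (of_nat k powr (2 * s + 1) * (pochhammer (-s) k / pochhammer (s + 1) k)
             - rGamma (-s) * Gamma (s + 1)) \<le> P / real k"
    using pochhammer_quotient_uniform[OF \<sigma> B] by metis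
  obtain J where J: "J > 0" "\<And>k s. \<sigma> \<le> Re s \<Longrightarrow> norm s \<le> B \<Longrightarrow> norm (jcoeff (\<lambda>_. 1) k s) \<le> J"
    using jcoeff_bounded[OF \<sigma>, of "\<lambda>_. 1"] by (metis continuous_on_const)
  define N where "N = M1 + (B + 1) * M2 + (B + 1)\<^sup>2 * M3"
  have N: "N > 0" using M1(1) M2(1) M3(1) B by (auto simp: N_def intro!: add_pos_nonneg mult_nonneg_nonneg)
  define M where "M = norm (H 1) * (J * P) + 2 * N"
  have M: "M > 0" using N J(1) P(1) by (auto simp: M_def intro!: add_nonneg_pos)
  show ?thesis
  proof (rule that[OF M])
    fix k :: nat and s :: complex assume k: "k \<ge> 1" and s: "\<sigma> \<le> Re s" "norm s \<le> B"
    define X where "X = real k powr (- 2 * Re s - 1) + 1 / real k ^ (2 * m)"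
    have X: "X \<ge> 0" by (auto simp: X_def)
    define Q where "Q = jcoeff H1 k s + (s + 1) * jcoeff H2 k s + (s + 1)\<^sup>2 * jcoeff H3 k s"
    have s': "Re s > - 1 / 2" using s \<sigma> by simp
    have s1: "norm (s + 1) \<le> B + 1" using s norm_triangle_ineq[of s 1] by simp
    have "norm Q \<le> M1 * X + (B + 1) * (M2 * X) + (B + 1)\<^sup>2 * (M3 * X)"
      using M1(2)[OF k s] M2(2)[OF k s] M3(2)[OF k s] s1 B unfolding X_def[symmetric] Q_def
      by (intro order_trans[OF norm_triangle_ineq] add_mono) (auto simp: norm_mult norm_power intro!: mult_mono power_mono)
    then have Q: "norm Q \<le> N * X" by (simp add: N_def algebra_simps)
    have kX: "real k powr (2 * Re s + 1) * X \<le> 2"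
    proof -
      have "real k powr (2 * Re s + 1) * (1 / real k ^ (2 * m)) = real k powr (2 * Re s + 1 - real (2 * m))"
        using k powr_realpow[of "real k" "2 * m"] by (simp add: powr_diff)
      also have "\<dots> \<le> real k powr 0"
        using k m s complex_Re_le_cmod[of s] by (intro powr_mono) auto
      finally have "real k powr (2 * Re s + 1) * (1 / real k ^ (2 * m)) \<le> 1" using k by simp
      moreover have "real k powr (2 * Re s + 1) * real k powr (- 2 * Re s - 1) = 1"
        using k by (simp add: powr_add[symmetric])
      ultimately show ?thesis by (simp add: X_def distrib_left)
    qed
    have "of_nat k powr (2 * s + 1) * jcoeff H k s - H 1 * lead_fun s =
      H 1 * jcoeff (\<lambda>_. 1) 0 s * (of_nat k powr (2 * s + 1) * (pochhammer (-s) k / pochhammer (s + 1) k)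
             - rGamma (-s) * Gamma (s + 1)) - of_nat k powr (2 * s + 1) * Q / of_nat k ^ 2"
      unfolding split[OF k s'] lead_fun_def Q_def[symmetric] jcoeff_one_eq[OF s', of k] by (simp add: algebra_simps)
    also have "norm \<dots> \<le> norm (H 1) * J * (P / real k) + real k powr (2 * Re s + 1) * (N * X) / real k ^ 2"
    proof (intro order_trans[OF norm_triangle_ineq4] add_mono)
      show "norm (H 1 * jcoeff (\<lambda>_. 1) 0 s * (of_nat k powr (2 * s + 1) * (pochhammer (-s) k / pochhammer (s + 1) k)
             - rGamma (-s) * Gamma (s + 1))) \<le> norm (H 1) * J * (P / real k)"
        unfolding norm_mult[of "H 1 * _"] norm_mult[of "H 1"]
        using J(1) J(2)[OF s, of 0] P(2)[OF k s] by (intro mult_mono) auto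
      show "norm (of_nat k powr (2 * s + 1) * Q / of_nat k ^ 2) \<le> real k powr (2 * Re s + 1) * (N * X) / real k ^ 2"
        using Q k by (auto simp: norm_mult norm_divide norm_power norm_nat_powr intro!: mult_left_mono divide_right_mono)
    qed
    also have "real k powr (2 * Re s + 1) * (N * X) / real k ^ 2 \<le> 2 * N / real k"
    proof -
      have "real k powr (2 * Re s + 1) * (N * X) / real k ^ 2 = N * (real k powr (2 * Re s + 1) * X) / real k ^ 2" by simp
      also have "\<dots> \<le> N * 2 / real k ^ 2" using kX N by (intro divide_right_mono mult_left_mono) auto
      also have "\<dots> \<le> N * 2 / real k" using k N by (intro divide_left_mono) (auto simp: power2_eq_square)
      finally show ?thesis by (simp only: mult.commute)
    qed
    finally show "norm (of_nat k powr (2 * s + 1) * jcoeff H k s - H 1 * lead_fun s) \<le> M / real k"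
      by (simp add: M_def add_divide_distrib)
  qed
qed

section \<open>Differentiation with respect to the exponent\<close>

text \<open>The substitution x = cos t: the Jacobian sin t cancels sqrt (1 - x^2). It is carried out
  on open intervals, where \<open>cos\<close> is injective and the weight is finite.\<close>

lemma cheb_coeff_eq_integral_cos:
  fixes f :: "real \<Rightarrow> complex"
  assumes cont: "continuous_on {-1<..<1} f"
    and int: "(\<lambda>t. f (cos t) * of_real (cos (real k * t))) absolutely_integrable_on {0<..<pi}"
  shows "cheb_coeff f k = of_real (2 / pi) * integral {0<..<pi} (\<lambda>t. f (cos t) * of_real (cos (real k * t)))"
proof -
  define F where "F = (\<lambda>x. f x * of_real (cheb_T k x / sqrt (1 - x\<^sup>2)))"
  have img: "cos ` {0<..<pi} = {-1<..<1}"
  proof safe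
    fix t :: real assume t: "t \<in> {0<..<pi}"
    have "cos pi < cos t" "cos t < cos 0" using t by (intro cos_monotone_0_pi; simp)+
    then show "cos t \<in> {-1<..<1}" by simp
  next
    fix u :: real assume u: "u \<in> {-1<..<1}"
    then have "arccos u \<in> {0<..<pi}" using arccos_lt_bounded[of u] by auto
    moreover have "cos (arccos u) = u" using u by simp
    ultimately show "u \<in> cos ` {0<..<pi}" by (metis image_eqI)
  qed
  have inj: "inj_on cos {0<..<pi}"
    by (rule inj_onI) (auto dest!: cos_inj_pi[rotated 4])
  have der: "(cos has_field_derivative - sin t) (at t within {0<..<pi})" for t :: real
    by (auto intro!: derivative_eq_intros)
  have eq: "\<bar>- sin t\<bar> *\<^sub>R F (cos t) = f (cos t) * of_real (cos (real k * t))" if t: "t \<in> {0<..<pi}" for t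
  proof -
    have s: "sin t > 0" using t by (auto intro: sin_gt_zero)
    then have "sqrt (1 - (cos t)\<^sup>2) = sin t"
      by (simp add: sin_squared_eq[symmetric])
    then show ?thesis using t s
      by (simp add: F_def cheb_T_def arccos_cos scaleR_conv_of_real)
  qed
  have "(\<lambda>t. \<bar>- sin t\<bar> *\<^sub>R F (cos t)) absolutely_integrable_on {0<..<pi} \<longleftrightarrow>
      (\<lambda>t. f (cos t) * of_real (cos (real k * t))) absolutely_integrable_on {0<..<pi}"
    using eq by (intro set_integrable_cong) auto
  then have "(\<lambda>t. \<bar>- sin t\<bar> *\<^sub>R F (cos t)) absolutely_integrable_on {0<..<pi}"
    using int by simp
  moreover have "integral {0<..<pi} (\<lambda>t. \<bar>- sin t\<bar> *\<^sub>R F (cos t))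
     = integral {0<..<pi} (\<lambda>t. f (cos t) * of_real (cos (real k * t)))"
    using eq by (rule integral_cong)
  ultimately have "F absolutely_integrable_on cos ` {0<..<pi} \<and> integral (cos ` {0<..<pi}) F
     = integral {0<..<pi} (\<lambda>t. f (cos t) * of_real (cos (real k * t)))"
    by (subst has_absolute_integral_change_of_variables_real[OF _ der inj, symmetric]) auto
  then have F: "F absolutely_integrable_on {-1<..<1}" "integral {-1<..<1} F
     = integral {0<..<pi} (\<lambda>t. f (cos t) * of_real (cos (real k * t)))"
    unfolding img by auto
  have nz: "sqrt (1 - x\<^sup>2) \<noteq> 0" if "x \<in> {-1<..<1}" for x :: real
    using abs_square_less_1[of x] that by auto
  \<comment> \<open>Continuity gives Borel measurability, which turns integrability for the
    completed measure into integrability for \<open>lborel\<close>.\<close>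
  then have contF: "continuous_on {-1<..<1} F"
    unfolding F_def cheb_T_def by (intro continuous_intros cont ballI nz) auto
  then have meas: "(\<lambda>x. indicator {-1<..<1} x *\<^sub>R F x) \<in> borel_measurable lborel"
    using borel_measurable_continuous_on_indicator[of "{-1<..<1}" F] by simp
  then have "set_integrable lborel {-1<..<1} F"
    using F(1) unfolding set_integrable_def by (simp add: integrable_completion)
  then have "(LBINT x:{-1<..<1}. F x) = integral {-1<..<1} F"
    by (rule set_borel_integral_eq_integral)
  \<comment> \<open>At both end points \<open>F\<close> is 0, since division by sqrt 0 gives
    0.\<close>
  moreover have "(LBINT x:{-1..1}. F x) = (LBINT x:{-1<..<1}. F x)"
    unfolding set_lebesgue_integral_def
    by (rule Bochner_Integration.integral_cong) (auto simp: indicator_def F_def power2_eq_1_iff)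
  ultimately show ?thesis
    unfolding cheb_coeff_def F_def[symmetric] F(2)[symmetric] by (simp only:)
qed

section \<open>Power series of the coefficients in the exponent\<close>

lemma higher_deriv_power_series:
  fixes f :: "complex \<Rightarrow> complex"
  assumes r: "r > 0" and sums: "\<And>w. w \<in> ball z r \<Longrightarrow> (\<lambda>n. a n * (w - z) ^ n) sums f w"
  shows "(deriv ^^ n) f z = fact n * a n"
proof -
  define F where "F = Abs_fps a"
  have s: "(\<lambda>n. a n * w ^ n) sums f (z + w)" if "norm w < r" for w
    using sums[of "z + w"] that by (simp add: dist_norm)
  have "ereal (norm (complex_of_real (r / 2))) \<le> conv_radius a"
    using s[of "of_real (r / 2)"] r by (intro conv_radius_geI) (auto dest: sums_summable)
  moreover have "ereal (norm (complex_of_real (r / 2))) > 0" using r by simp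
  ultimately have "conv_radius a > 0" by (rule less_le_trans[rotated])
  then have rad: "fps_conv_radius F > 0"
    by (simp add: fps_conv_radius_def F_def)
  have "\<forall>\<^sub>F w in nhds 0. w \<in> ball (0 :: complex) r"
    using r by (intro eventually_nhds_in_open) auto
  then have "\<forall>\<^sub>F w in nhds 0. eval_fps F w = (f \<circ> (\<lambda>x. z + x)) w"
  proof eventually_elim
    case (elim w)
    then show ?case using sums_unique[OF s[of w]] by (simp add: eval_fps_def F_def)
  qed
  with rad have "(f \<circ> (\<lambda>x. z + x)) has_fps_expansion F"
    by (simp add: has_fps_expansion_def)
  from fps_nth_fps_expansion[OF this, of n] show ?thesis
    by (subst higher_deriv_shift_0) (simp add: F_def)
qed

lemma sum_power_div_fact_le_exp:
  fixes x :: real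
  assumes "x \<ge> 0"
  shows "(\<Sum>n<N. x ^ n / fact n) \<le> exp x"
proof -
  have "(\<lambda>n. x ^ n / fact n) sums exp x"
    using exp_converges[of x] by (simp add: divide_inverse mult.commute)
  then show ?thesis
    using sum_le_suminf[of "\<lambda>n. x ^ n / fact n" "{..<N}"] assms by (auto simp: sums_iff)
qed

text \<open>The exponential is \<open>w powr r\<close> or \<open>w powr (- r)\<close> according to
  the sign of \<open>ln w\<close>. The sum of both powers is an integrable majorant near 0 and away
  from it.\<close>

lemma powr_mult_exp_abs_ln_le:
  fixes w \<gamma> r :: real
  assumes "w > 0"
  shows "w powr \<gamma> * exp (r * \<bar>ln w\<bar>) \<le> w powr (\<gamma> + r) + w powr (\<gamma> - r)"
  using assms by (auto simp: powr_def abs_if exp_add[symmetric] algebra_simps)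

text \<open>Expand w powr s = w powr \<gamma> * exp ((s - \<gamma>) ln w) with w = 1 - cos t and
  integrate term by term. The partial sums are dominated by a multiple of w powr (\<gamma> + r) + w
  powr (\<gamma> - r), integrable because \<gamma> - r > -1/2. This yields both holomorphy in s and
  the derivatives.\<close>

lemma jcoeff_power_series:
  fixes \<gamma> r :: real
  assumes r: "r > 0" "\<gamma> - r > - 1 / 2" and H: "continuous_on (complex_of_real ` {-1..1}) H"
  shows "(\<lambda>t. of_real ((1 - cos t) powr \<gamma> * ln (1 - cos t) ^ n) * (H (of_real (cos t)) * of_real (cos (real k * t))))
            absolutely_integrable_on {0..pi}"
    and "s \<in> ball (of_real \<gamma>) r \<Longrightarrow>
      (\<lambda>n. integral {0..pi} (\<lambda>t. of_real ((1 - cos t) powr \<gamma> * ln (1 - cos t) ^ n) *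
              (H (of_real (cos t)) * of_real (cos (real k * t)))) / fact n * (s - of_real \<gamma>) ^ n)
        sums jcoeff H k s"
proof -
  define \<phi> where "\<phi> = (\<lambda>t. H (of_real (cos t)) * complex_of_real (cos (real k * t)))"
  define w where "w = (\<lambda>t::real. 1 - cos t)"
  define g where "g = (\<lambda>n t. of_real (w t powr \<gamma> * ln (w t) ^ n) * \<phi> t)"
  have wpos: "w t > 0" if "t \<in> {0<..pi}" for t
    using one_minus_cos_bounds(3)[OF that] by (simp add: w_def)
  have wnz: "w t \<noteq> 0" if "t \<in> {0<..pi}" for t
    using wpos[OF that] by simp
  have w_cont: "continuous_on A w" for A
    unfolding w_def by (intro continuous_intros)
  have \<phi>_cont: "continuous_on A \<phi>" for A
    unfolding \<phi>_def by (intro continuous_intros H)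
  have "compact (\<phi> ` {0..pi})" using \<phi>_cont by (intro compact_continuous_image) auto
  then obtain K where K: "\<And>t. t \<in> {0..pi} \<Longrightarrow> norm (\<phi> t) \<le> K"
    by (metis bounded_iff compact_imp_bounded imageI)
  have K0: "K \<ge> 0" using order_trans[OF norm_ge_zero K[of 0]] by simp
  have g_int: "g n absolutely_integrable_on {0..pi}" for n
  \<comment> \<open>A single term of the exponential series bounds the n-th power of the logarithm,
    giving \<open>fact n / r ^ n\<close>; reducing the exponent \<gamma> + r to \<gamma> - r costs
    \<open>2 powr (2 * r)\<close>.\<close>
  proof (rule absolutely_integrable_one_minus_cos_bound[where M = "fact n / r ^ n * (2 powr (2 * r) + 1) * K"])
    show "continuous_on {0<..pi} (g n)"
      unfolding g_def by (intro continuous_intros \<phi>_cont w_cont ballI wnz)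
    fix t :: real assume t: "t \<in> {0<..pi}"
    have "(r * \<bar>ln (w t)\<bar>) ^ n / fact n \<le> (\<Sum>m<Suc n. (r * \<bar>ln (w t)\<bar>) ^ m / fact m)"
      using r by (intro member_le_sum) auto
    also have "\<dots> \<le> exp (r * \<bar>ln (w t)\<bar>)" using r by (intro sum_power_div_fact_le_exp) auto
    finally have "\<bar>ln (w t)\<bar> ^ n \<le> fact n / r ^ n * exp (r * \<bar>ln (w t)\<bar>)"
      using r by (simp add: power_mult_distrib field_simps)
    then have "w t powr \<gamma> * \<bar>ln (w t)\<bar> ^ n \<le> w t powr \<gamma> * (fact n / r ^ n * exp (r * \<bar>ln (w t)\<bar>))"
      by (intro mult_left_mono) auto
    also have "\<dots> = fact n / r ^ n * (w t powr \<gamma> * exp (r * \<bar>ln (w t)\<bar>))" by (simp only: mult_ac)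
    also have "\<dots> \<le> fact n / r ^ n * (w t powr (\<gamma> + r) + w t powr (\<gamma> - r))"
      using r by (intro mult_left_mono powr_mult_exp_abs_ln_le wpos t) auto
    also have "\<dots> \<le> fact n / r ^ n * (2 powr (2 * r) * w t powr (\<gamma> - r) + w t powr (\<gamma> - r))"
      using r one_minus_cos_powr_le[of "\<gamma> - r" "\<gamma> + r" t] by (intro mult_left_mono add_right_mono) (auto simp: w_def)
    finally have 1: "w t powr \<gamma> * \<bar>ln (w t)\<bar> ^ n \<le> fact n / r ^ n * (2 powr (2 * r) + 1) * w t powr (\<gamma> - r)"
      by (simp add: algebra_simps)
    have "norm (g n t) = w t powr \<gamma> * \<bar>ln (w t)\<bar> ^ n * norm (\<phi> t)"
      by (simp add: g_def norm_mult abs_mult power_abs del: of_real_mult of_real_power)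
    also have "\<dots> \<le> (fact n / r ^ n * (2 powr (2 * r) + 1) * w t powr (\<gamma> - r)) * K"
      using t r by (intro mult_mono[OF 1 K]) auto
    finally show "norm (g n t) \<le> fact n / r ^ n * (2 powr (2 * r) + 1) * K * (1 - cos t) powr (\<gamma> - r)"
      by (simp add: w_def mult_ac)
  qed (use r in auto)
  then show "(\<lambda>t. of_real ((1 - cos t) powr \<gamma> * ln (1 - cos t) ^ n) * (H (of_real (cos t)) * of_real (cos (real k * t))))
            absolutely_integrable_on {0..pi}"
    by (simp add: g_def w_def \<phi>_def)
  assume s: "s \<in> ball (of_real \<gamma>) r"
  define \<delta> where "\<delta> = s - of_real \<gamma>"
  have \<delta>: "norm \<delta> \<le> r" using s by (simp add: \<delta>_def dist_norm norm_minus_commute)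
  have conv: "(\<lambda>N. integral {0..pi} (\<lambda>t. \<Sum>n<N. \<delta> ^ n / fact n * g n t)) \<longlonglongrightarrow> integral {0..pi} (\<lambda>t. of_real (w t) powr s * \<phi> t)"
  proof (rule dominated_convergence(2))
    show "(\<lambda>t. \<Sum>n<N. \<delta> ^ n / fact n * g n t) integrable_on {0..pi}" for N
      by (intro integrable_sum integrable_on_mult_right set_lebesgue_integral_eq_integral(1) g_int) auto
    show "(\<lambda>t. K * (w t powr (\<gamma> + r) + w t powr (\<gamma> - r))) integrable_on {0..pi}"
      unfolding w_def using r
      by (intro integrable_on_mult_right integrable_add has_integral_integrable[OF has_integral_one_minus_cos_powr]) auto
    fix N and t :: real assume t: "t \<in> {0..pi}"
    show "norm (\<Sum>n<N. \<delta> ^ n / fact n * g n t) \<le> K * (w t powr (\<gamma> + r) + w t powr (\<gamma> - r))"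
    \<comment> \<open>At \<open>t = 0\<close> every summand vanishes, since 0 powr anything is
      0.\<close>
    proof (cases "t = 0")
      case False
      then have wt: "w t > 0" using t by (intro wpos) auto
      have "norm (\<Sum>n<N. \<delta> ^ n / fact n * g n t) \<le> (\<Sum>n<N. (w t powr \<gamma> * K) * ((r * \<bar>ln (w t)\<bar>) ^ n / fact n))"
      proof (rule order_trans[OF norm_sum sum_mono])
        fix n
        have "norm (\<delta> ^ n / fact n * g n t) = (norm \<delta> ^ n * \<bar>ln (w t)\<bar> ^ n / fact n) * w t powr \<gamma> * norm (\<phi> t)"
          by (simp add: g_def norm_mult norm_divide norm_power abs_mult power_abs del: of_real_mult of_real_power)
        also have "\<dots> \<le> (r ^ n * \<bar>ln (w t)\<bar> ^ n / fact n) * w t powr \<gamma> * K"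
          using \<delta> K[OF t] r by (intro mult_mono divide_right_mono power_mono) auto
        finally show "norm (\<delta> ^ n / fact n * g n t) \<le> (w t powr \<gamma> * K) * ((r * \<bar>ln (w t)\<bar>) ^ n / fact n)"
          by (simp add: power_mult_distrib mult_ac)
      qed
      also have "\<dots> \<le> (w t powr \<gamma> * K) * exp (r * \<bar>ln (w t)\<bar>)"
        unfolding sum_distrib_left[symmetric] using r K0 by (intro mult_left_mono sum_power_div_fact_le_exp) auto
      also have "\<dots> \<le> K * (w t powr (\<gamma> + r) + w t powr (\<gamma> - r))"
        using mult_left_mono[OF powr_mult_exp_abs_ln_le[OF wt] K0] by (simp add: mult_ac)
      finally show ?thesis .
    qed (simp add: g_def w_def)
    show "(\<lambda>N. \<Sum>n<N. \<delta> ^ n / fact n * g n t) \<longlonglongrightarrow> of_real (w t) powr s * \<phi> t"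
    proof (cases "t = 0")
      case False
      then have wt: "w t > 0" using t by (intro wpos) auto
      have "(\<lambda>n. (\<delta> * of_real (ln (w t))) ^ n / fact n) sums exp (\<delta> * of_real (ln (w t)))"
        using exp_converges[of "\<delta> * of_real (ln (w t))"] by (simp add: scaleR_conv_of_real divide_inverse mult.commute)
      then have "(\<lambda>n. of_real (w t powr \<gamma>) * \<phi> t * ((\<delta> * of_real (ln (w t))) ^ n / fact n))
         sums (of_real (w t powr \<gamma>) * \<phi> t * exp (\<delta> * of_real (ln (w t))))"
        by (rule sums_mult)
      moreover have "of_real (w t powr \<gamma>) * \<phi> t * ((\<delta> * of_real (ln (w t))) ^ n / fact n) = \<delta> ^ n / fact n * g n t" for n
        by (simp add: g_def power_mult_distrib mult_ac)
      moreover have "of_real (w t powr \<gamma>) * \<phi> t * exp (\<delta> * of_real (ln (w t))) = of_real (w t) powr s * \<phi> t"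
      proof -
        have "complex_of_real (w t) powr s = exp (of_real (\<gamma> * ln (w t)) + \<delta> * of_real (ln (w t)))"
          using wt by (simp add: powr_def Ln_of_real \<delta>_def algebra_simps)
        also have "\<dots> = of_real (w t powr \<gamma>) * exp (\<delta> * of_real (ln (w t)))"
          using wt by (simp only: exp_add exp_of_real) (simp add: powr_def)
        finally show ?thesis by (simp add: mult_ac)
      qed
      ultimately show ?thesis by (simp add: sums_def)
    qed (simp add: g_def w_def)
  qed
  moreover have "integral {0..pi} (\<lambda>t. \<Sum>n<N. \<delta> ^ n / fact n * g n t) = (\<Sum>n<N. integral {0..pi} (g n) / fact n * \<delta> ^ n)" for N
    by (subst integral_sum) (auto intro!: integrable_on_mult_right set_lebesgue_integral_eq_integral(1) g_int simp: mult.commute)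
  ultimately have "(\<lambda>n. integral {0..pi} (g n) / fact n * \<delta> ^ n) sums integral {0..pi} (\<lambda>t. of_real (w t) powr s * \<phi> t)"
    by (simp add: sums_def)
  then show "(\<lambda>n. integral {0..pi} (\<lambda>t. of_real ((1 - cos t) powr \<gamma> * ln (1 - cos t) ^ n) *
              (H (of_real (cos t)) * of_real (cos (real k * t)))) / fact n * (s - of_real \<gamma>) ^ n)
        sums jcoeff H k s"
    by (simp add: g_def[abs_def] w_def \<phi>_def \<delta>_def jcoeff_def)
qed

section \<open>The leading function on the real axis\<close>

definition lead_real :: "real \<Rightarrow> real" where
  "lead_real t = - (2 powr (- t) * sin (pi * t) * Gamma (2 * t + 1))"

text \<open>The reflection formula turns the reciprocal Gamma factor at -t into a sine, and Legendre
  duplication merges the values at t + 1/2 (from the Beta integral) and t + 1 into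
  \<open>Gamma (2 * t + 1)\<close>.\<close>

lemma lead_fun_of_real:
  fixes t :: real
  assumes t: "t > - 1 / 2"
  shows "lead_fun (of_real t) = of_real (lead_real t)"
proof -
  have J: "jcoeff (\<lambda>_. 1) 0 (of_real t) = of_real (2 powr t * Beta (t + 1 / 2) (1 / 2))"
  proof -
    have "((\<lambda>x. complex_of_real ((1 - cos x) powr t)) has_integral of_real (2 powr t * Beta (t + 1 / 2) (1 / 2))) {0..pi}"
      using has_integral_one_minus_cos_powr[OF t] has_integral_of_real by blast
    moreover have "complex_of_real (1 - cos x) powr of_real t = of_real ((1 - cos x) powr t)" for x
      using one_minus_cos_bounds(1)[of x] by (subst powr_of_real) auto
    ultimately show ?thesis unfolding jcoeff_def by (simp add: integral_unique)
  qed
  have "Gamma (t + 1) > 0" using t by (intro Gamma_real_pos) auto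
  then have nz: "Gamma (t + 1) \<noteq> 0" by simp
  \<comment> \<open>Reflection in terms of \<open>rGamma\<close> also covers t = 0, 1, 2, ..., where
    \<open>Gamma\<close> has a pole at -t and both sides are 0.\<close>
  have refl: "rGamma (- complex_of_real t) * Gamma (of_real t + 1) = of_real (- sin (pi * t) / pi * (Gamma (t + 1))\<^sup>2)"
  proof -
    have "rGamma (- complex_of_real t) * rGamma (1 + of_real t) = - sin (of_real pi * of_real t) / of_real pi"
      using rGamma_reflection_complex[of "- of_real t"] by simp
    moreover have "rGamma (1 + complex_of_real t) = of_real (1 / Gamma (t + 1))"
      by (metis add.commute of_real_1 of_real_add rGamma_complex_of_real rGamma_inverse_Gamma inverse_eq_divide)
    ultimately have "rGamma (- complex_of_real t) * of_real (1 / Gamma (t + 1)) = of_real (- sin (pi * t) / pi)"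
      by (simp add: sin_of_real[symmetric])
    then have "rGamma (- complex_of_real t) = of_real (- sin (pi * t) / pi * Gamma (t + 1))"
      using nz by (simp add: field_simps)
    moreover have "Gamma (complex_of_real t + 1) = of_real (Gamma (t + 1))"
      by (metis of_real_1 of_real_add Gamma_complex_of_real)
    ultimately show ?thesis by (simp only: of_real_mult[symmetric] power2_eq_square mult.assoc)
  qed
  have dup: "Gamma (t + 1 / 2) * Gamma (t + 1) = 2 powr (- 2 * t) * sqrt pi * Gamma (2 * t + 1)"
  proof -
    have "of_real t + 1 / 2 \<notin> (\<int>\<^sub>\<le>\<^sub>0 :: complex set)" "of_real t + 1 / 2 + 1 / 2 \<notin> (\<int>\<^sub>\<le>\<^sub>0 :: complex set)"
      using t by (auto elim!: nonpos_Ints_cases simp: complex_eq_iff)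
    from Gamma_legendre_duplication[OF this]
    have "complex_of_real (Gamma (t + 1 / 2) * Gamma (t + 1)) = of_real (exp ((1 - 2 * (t + 1 / 2)) * ln 2) * sqrt pi * Gamma (2 * (t + 1 / 2)))"
      by (simp add: Gamma_complex_of_real[symmetric] exp_of_real[symmetric] add.commute distrib_left)
    then have "Gamma (t + 1 / 2) * Gamma (t + 1) = exp ((1 - 2 * (t + 1 / 2)) * ln 2) * sqrt pi * Gamma (2 * (t + 1 / 2))"
      by (simp only: of_real_eq_iff)
    then show ?thesis by (simp add: powr_def algebra_simps)
  qed
  have "lead_fun (of_real t) = of_real (2 powr t * Beta (t + 1 / 2) (1 / 2) * (- sin (pi * t) / pi * (Gamma (t + 1))\<^sup>2))"
    unfolding lead_fun_def J refl by simp
  also have "2 powr t * Beta (t + 1 / 2) (1 / 2) * (- sin (pi * t) / pi * (Gamma (t + 1))\<^sup>2)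
     = - (2 powr t * (Gamma (t + 1 / 2) * Gamma (t + 1)) * sqrt pi * sin (pi * t) / pi)"
    using nz by (simp add: Beta_def Gamma_one_half_real power2_eq_square add.commute)
  also have "\<dots> = - ((2 powr t * 2 powr (- 2 * t)) * Gamma (2 * t + 1) * sin (pi * t) * (sqrt pi * sqrt pi / pi))"
    unfolding dup by (simp only: times_divide_eq_right times_divide_eq_left mult_ac)
  also have "\<dots> = lead_real t"
    unfolding powr_add[symmetric] lead_real_def by (simp add: mult_ac)
  finally show ?thesis .
qed

lemma lead_real_has_derivative:
  fixes t :: real
  assumes t: "t > - 1 / 2"
  shows "(lead_real has_field_derivative
     2 powr (- t) * (ln 2 * sin (pi * t) * Gamma (2 * t + 1) - pi * cos (pi * t) * Gamma (2 * t + 1)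
        - 2 * sin (pi * t) * deriv Gamma (2 * t + 1))) (at t)"
proof -
  have nz: "2 * t + 1 \<notin> \<int>\<^sub>\<le>\<^sub>0" using t by (auto elim!: nonpos_Ints_cases)
  then have "deriv Gamma (2 * t + 1) = Gamma (2 * t + 1) * Digamma (2 * t + 1)"
    by (intro DERIV_imp_deriv has_field_derivative_Gamma)
  with nz show ?thesis unfolding lead_real_def[abs_def]
    by (auto intro!: derivative_eq_intros simp: algebra_simps)
qed

lemma ball_imp_Re_gt:
  assumes "s \<in> ball (complex_of_real \<gamma>) r" "\<gamma> - r > - 1 / 2"
  shows "Re s > - 1 / 2"
  using assms abs_Re_le_cmod[of "of_real \<gamma> - s"] by (auto simp: dist_norm)

lemma jcoeff_holomorphic:
  assumes "r > 0" "\<gamma> - r > - 1 / 2" "continuous_on (complex_of_real ` {-1..1}) H"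
  shows "jcoeff H k holomorphic_on ball (of_real \<gamma>) r"
  using jcoeff_power_series(2)[OF assms] by (rule power_series_holomorphic)

lemma lead_fun_holomorphic:
  assumes "r > 0" "\<gamma> - r > - 1 / 2"
  shows "lead_fun holomorphic_on ball (of_real \<gamma>) r"
proof -
  have "s + 1 \<notin> \<int>\<^sub>\<le>\<^sub>0" if "s \<in> ball (of_real \<gamma>) r" for s :: complex
    using ball_imp_Re_gt[OF that assms(2)] by (auto elim!: nonpos_Ints_cases simp: complex_eq_iff)
  then show ?thesis
    unfolding lead_fun_def[abs_def]
    by (intro holomorphic_intros jcoeff_holomorphic assms continuous_on_const) auto
qed

text \<open>By the chain rule along the embedding of the reals, the complex derivative is the
  derivative of the restriction to the real axis, which is \<open>lead_real\<close>.\<close>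

lemma deriv_lead_fun_of_real:
  fixes \<gamma> :: real
  assumes "r > 0" "\<gamma> - r > - 1 / 2"
  shows "deriv lead_fun (of_real \<gamma>) = of_real (deriv lead_real \<gamma>)"
proof -
  have \<gamma>: "\<gamma> > - 1 / 2" using assms by simp
  have "(lead_fun has_field_derivative deriv lead_fun (of_real \<gamma>)) (at (of_real \<gamma>))"
    by (rule holomorphic_derivI[OF lead_fun_holomorphic[OF assms]]) (use assms in auto)
  moreover have "(complex_of_real has_vector_derivative of_real 1) (at \<gamma>)"
    by (intro has_vector_derivative_of_real) (auto intro!: derivative_eq_intros)
  ultimately have "((\<lambda>t. lead_fun (of_real t)) has_vector_derivative deriv lead_fun (of_real \<gamma>)) (at \<gamma>)"
    using field_vector_diff_chain_at[of complex_of_real "of_real 1" \<gamma> lead_fun] by (simp add: o_def)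
  then have "((\<lambda>t. complex_of_real (lead_real t)) has_vector_derivative deriv lead_fun (of_real \<gamma>)) (at \<gamma>)"
    by (rule has_vector_derivative_transform_within_open[where S = "{- 1 / 2<..}"])
       (use \<gamma> lead_fun_of_real in auto)
  moreover have "((\<lambda>t. complex_of_real (lead_real t)) has_vector_derivative of_real (deriv lead_real \<gamma>)) (at \<gamma>)"
    using DERIV_imp_deriv[OF lead_real_has_derivative[OF \<gamma>]] lead_real_has_derivative[OF \<gamma>]
    by (intro has_vector_derivative_of_real) (simp add: has_real_derivative_iff_has_vector_derivative)
  ultimately show ?thesis by (rule vector_derivative_unique_at)
qed

lemma lead_coeff_ln_eq:
  "lead_coeff_ln \<gamma> \<mu> = 2 / pi * (-2) ^ \<mu> * lead_real \<gamma>"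
proof -
  have "2 powr (real \<mu> + 1 - \<gamma>) = 2 ^ \<mu> * 2 * 2 powr (- \<gamma>)"
    by (simp add: powr_add[symmetric] powr_diff powr_add powr_realpow powr_minus divide_inverse)
  moreover have "(-2 :: real) ^ \<mu> = (-1) ^ \<mu> * 2 ^ \<mu>" by (simp flip: power_mult_distrib)
  ultimately show ?thesis
    by (simp add: lead_coeff_ln_def lead_real_def mult.commute[of pi])
qed

lemma sec_coeff_ln_eq:
  assumes "\<mu> \<ge> 1" "\<gamma> > - 1 / 2"
  shows "sec_coeff_ln \<gamma> \<mu> = 2 / pi * (real \<mu> * (-2) ^ (\<mu> - 1) * deriv lead_real \<gamma>)"
proof -
  obtain n where n: "\<mu> = Suc n" using assms by (cases \<mu>) auto
  have "2 powr (real \<mu> - \<gamma>) = 2 ^ \<mu> * 2 powr (- \<gamma>)"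
    by (simp add: powr_diff powr_realpow powr_minus divide_inverse)
  moreover have "(-2 :: real) ^ n = (-1) ^ n * 2 ^ n" by (simp flip: power_mult_distrib)
  ultimately show ?thesis
    unfolding sec_coeff_ln_def DERIV_imp_deriv[OF lead_real_has_derivative[OF assms(2)]] n
    by (simp add: field_simps)
qed

section \<open>Estimates for derivatives in the exponent\<close>

lemma higher_deriv_exp_linear:
  fixes c :: complex
  shows "(deriv ^^ i) (\<lambda>s. exp (c * s + d)) = (\<lambda>s. c ^ i * exp (c * s + d))"
proof (induction i)
  case (Suc i)
  have "deriv (\<lambda>s. c ^ i * exp (c * s + d)) s = c ^ Suc i * exp (c * s + d)" for s
    by (rule DERIV_imp_deriv) (auto intro!: derivative_eq_intros)
  then show ?case using Suc by auto
qed simp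

text \<open>Apply ln x \<le> x - 1 at x = sqrt k. The inequality lets an error O(1/k) be absorbed
  into one of order 1 / (ln k)^2.\<close>

lemma ln_squared_le: "k \<ge> 1 \<Longrightarrow> (ln (real k))\<^sup>2 \<le> 4 * real k"
proof -
  assume k: "k \<ge> 1"
  have "ln (real k) = 2 * ln (sqrt (real k))" using k by (simp add: ln_sqrt)
  also have "\<dots> \<le> 2 * sqrt (real k)" using k ln_le_minus_one[of "sqrt (real k)"] by simp
  finally have "(ln (real k))\<^sup>2 \<le> (2 * sqrt (real k))\<^sup>2" using k by (intro power_mono) auto
  then show ?thesis using k by (simp add: power_mult_distrib)
qed

text \<open>Cauchy's inequality on the circle of radius r / 2 about \<gamma>, where the uniform
  asymptotics bound the difference by M / k.\<close>

lemma scaled_jcoeff_deriv_bound: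
  fixes \<gamma> r :: real
  assumes r: "r > 0" "\<gamma> - r > - 1 / 2"
    and U: "open U" "complex_of_real ` {-1..1} \<subseteq> U" and H: "H holomorphic_on U"
  obtains M where "M > 0" "\<And>k n. k \<ge> 1 \<Longrightarrow>
     norm ((deriv ^^ n) (\<lambda>s. of_nat k powr (2 * s + 1) * jcoeff H k s) (of_real \<gamma>)
           - H 1 * (deriv ^^ n) lead_fun (of_real \<gamma>)) \<le> fact n * M / (r / 2) ^ n / real k"
proof -
  \<comment> \<open>Bounds the modulus of every s within distance r of \<gamma>.\<close>
  define B where "B = \<bar>\<gamma>\<bar> + r"
  obtain M where M: "M > 0" "\<And>k s. k \<ge> 1 \<Longrightarrow> \<gamma> - r \<le> Re s \<Longrightarrow> norm s \<le> B \<Longrightarrow>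
           norm (of_nat k powr (2 * s + 1) * jcoeff H k s - H 1 * lead_fun s) \<le> M / real k"
    using jcoeff_asymp_uniform[OF r(2) _ U H, of B] r by (auto simp: B_def)
  have cont: "continuous_on (complex_of_real ` {-1..1}) H"
    using H U by (meson holomorphic_on_imp_continuous_on continuous_on_subset)
  show ?thesis
  proof (rule that[OF M(1)])
    fix k n :: nat assume k: "k \<ge> 1"
    let ?G = "\<lambda>s. of_nat k powr (2 * s + 1) * jcoeff H k s" and ?b = "ball (complex_of_real \<gamma>) r"
    have G: "?G holomorphic_on ?b"
      using k by (intro holomorphic_intros jcoeff_holomorphic r cont) auto
    have L: "(\<lambda>s. H 1 * lead_fun s) holomorphic_on ?b"
      by (intro holomorphic_intros lead_fun_holomorphic r)
    have D: "(\<lambda>s. ?G s - H 1 * lead_fun s) holomorphic_on ?b"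
      by (intro holomorphic_on_diff G L)
    have sub: "cball (complex_of_real \<gamma>) (r / 2) \<subseteq> ?b" using r by auto
    have "norm ((deriv ^^ n) (\<lambda>s. ?G s - H 1 * lead_fun s) (of_real \<gamma>)) \<le> fact n * (M / real k) / (r / 2) ^ n"
    proof (rule Cauchy_inequality)
      show "(\<lambda>s. ?G s - H 1 * lead_fun s) holomorphic_on ball (of_real \<gamma>) (r / 2)"
        using D by (rule holomorphic_on_subset) (use sub ball_subset_cball in blast)
      show "continuous_on (cball (of_real \<gamma>) (r / 2)) (\<lambda>s. ?G s - H 1 * lead_fun s)"
        using holomorphic_on_imp_continuous_on[OF D] sub by (rule continuous_on_subset)
      fix s assume s: "norm (complex_of_real \<gamma> - s) = r / 2"
      have "\<gamma> - r \<le> Re s" using s r abs_Re_le_cmod[of "of_real \<gamma> - s"] by auto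
      moreover have "norm s \<le> B"
        using s r norm_triangle_ineq4[of "of_real \<gamma>" "of_real \<gamma> - s"] by (simp add: B_def)
      ultimately show "norm (?G s - H 1 * lead_fun s) \<le> M / real k" by (rule M(2)[OF k])
    qed (use r in auto)
    moreover have "(deriv ^^ n) (\<lambda>s. ?G s - H 1 * lead_fun s) (of_real \<gamma>)
       = (deriv ^^ n) ?G (of_real \<gamma>) - (deriv ^^ n) (\<lambda>s. H 1 * lead_fun s) (of_real \<gamma>)"
      by (rule higher_deriv_diff[OF G L]) (use r in auto)
    moreover have "(deriv ^^ n) (\<lambda>s. H 1 * lead_fun s) (of_real \<gamma>) = H 1 * (deriv ^^ n) lead_fun (of_real \<gamma>)"
      by (rule higher_deriv_cmult[OF lead_fun_holomorphic[OF r]]) (use r in auto)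
    ultimately show "norm ((deriv ^^ n) ?G (of_real \<gamma>) - H 1 * (deriv ^^ n) lead_fun (of_real \<gamma>))
        \<le> fact n * M / (r / 2) ^ n / real k" by (simp add: mult.commute)
  qed
qed


text \<open>Differentiation under the integral sign, read off from the power series
  coefficients.\<close>

lemma higher_deriv_jcoeff:
  fixes \<gamma> r :: real
  assumes "r > 0" "\<gamma> - r > - 1 / 2" "continuous_on (complex_of_real ` {-1..1}) H"
  shows "(deriv ^^ n) (jcoeff H k) (of_real \<gamma>) =
    integral {0..pi} (\<lambda>t. of_real ((1 - cos t) powr \<gamma> * ln (1 - cos t) ^ n) *
              (H (of_real (cos t)) * of_real (cos (real k * t))))"
  using higher_deriv_power_series[OF assms(1) jcoeff_power_series(2)[OF assms], of n k] by simp

section \<open>Leibniz' rule and the logarithmic expansion\<close>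

theorem theorem2p3:
  fixes \<gamma> :: real and \<mu> :: nat and g1 :: "complex \<Rightarrow> complex" and f :: "real \<Rightarrow> complex"
  assumes "\<gamma> > - 1 / 2"
    and "\<mu> \<ge> 1"
    and "g1 analytic_on (complex_of_real ` {-1..1})"
    and "\<And>x. x \<in> {-1..<1} \<Longrightarrow>
           f x = of_real ((1 - x) powr \<gamma> * ln (1 - x) ^ \<mu>) * g1 (of_real x)"
  shows "(\<lambda>k. cheb_coeff f k
            - (of_real (lead_coeff_ln \<gamma> \<mu>) * g1 1
                 * of_real (ln (real k) ^ \<mu> / real k powr (2 * \<gamma> + 1))
               + of_real (sec_coeff_ln \<gamma> \<mu>) * g1 1
                 * of_real (ln (real k) ^ (\<mu> - 1) / real k powr (2 * \<gamma> + 1))))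
         \<in> O(\<lambda>k. of_real (ln (real k) powi (int \<mu> - 2) / real k powr (2 * \<gamma> + 1)))"
proof -
  obtain U where U: "open U" "complex_of_real ` {-1..1} \<subseteq> U" and g1: "g1 holomorphic_on U"
    using assms(3) unfolding analytic_on_holomorphic by blast
  have cont: "continuous_on (complex_of_real ` {-1..1}) g1"
    using g1 U by (meson holomorphic_on_imp_continuous_on continuous_on_subset)
  \<comment> \<open>Half the distance from \<gamma> to -1/2, so the disc about \<gamma> stays in the
    half-plane Re s > -1/2.\<close>
  define r where "r = (\<gamma> + 1 / 2) / 2"
  have r: "r > 0" "\<gamma> - r > - 1 / 2" using assms(1) by (auto simp: r_def field_simps)
  define G where "G = (\<lambda>k s. of_nat k powr (2 * s + 1) * jcoeff g1 k s)"
  obtain M where M: "M > 0" "\<And>k n. k \<ge> 1 \<Longrightarrow>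
     norm ((deriv ^^ n) (G k) (of_real \<gamma>) - g1 1 * (deriv ^^ n) lead_fun (of_real \<gamma>))
       \<le> fact n * M / (r / 2) ^ n / real k"
    using scaled_jcoeff_deriv_bound[OF r U g1] unfolding G_def by blast
  define C where "C = (\<lambda>n. fact n * M / (r / 2) ^ n)"
  have C0: "C n \<ge> 0" for n using M(1) r by (auto simp: C_def)
  define D where "D = (\<lambda>n. (deriv ^^ n) lead_fun (of_real \<gamma>))"
  \<comment> \<open>The limit of the n-th derivative of \<open>G\<close> for n = 0 and n = 1, which
    give the two explicit terms. For larger n the derivative goes entirely into the
    remainder.\<close>
  define e where "e = (\<lambda>n. if n \<le> 1 then g1 1 * D n else 0)"
  define K where "K = (\<lambda>i. 2 ^ i * (4 * C (\<mu> - i) + norm (g1 1 * D (\<mu> - i))))"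

  have cheb: "cheb_coeff f k = of_real (2 / pi) * (deriv ^^ \<mu>) (jcoeff g1 k) (of_real \<gamma>)" for k
  proof -
    let ?F = "\<lambda>t. of_real ((1 - cos t) powr \<gamma> * ln (1 - cos t) ^ \<mu>) * (g1 (of_real (cos t)) * of_real (cos (real k * t)))"
    have eq: "f (cos t) * of_real (cos (real k * t)) = ?F t" if t: "t \<in> {0<..<pi}" for t
      using one_minus_cos_bounds(3)[of t] t by (subst assms(4)) auto
    have "?F absolutely_integrable_on {0<..<pi}"
      using jcoeff_power_series(1)[OF r cont] by (simp only: absolutely_integrable_on_Icc_iff_Ioo)
    moreover have "(\<lambda>t. f (cos t) * of_real (cos (real k * t))) absolutely_integrable_on {0<..<pi}
       \<longleftrightarrow> ?F absolutely_integrable_on {0<..<pi}"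
      using eq by (intro set_integrable_cong) auto
    ultimately have "(\<lambda>t. f (cos t) * of_real (cos (real k * t))) absolutely_integrable_on {0<..<pi}"
      by blast
    moreover have "continuous_on {-1<..<1} f"
    proof -
      have "continuous_on {-1<..<1} (\<lambda>x. of_real ((1 - x) powr \<gamma> * ln (1 - x) ^ \<mu>) * g1 (of_real x))"
        by (intro continuous_intros continuous_on_compose2[OF cont]) auto
      then show ?thesis by (rule continuous_on_eq) (use assms(4) in auto)
    qed
    ultimately have "cheb_coeff f k = of_real (2 / pi) * integral {0<..<pi} (\<lambda>t. f (cos t) * of_real (cos (real k * t)))"
      by (intro cheb_coeff_eq_integral_cos)
    also have "integral {0<..<pi} (\<lambda>t. f (cos t) * of_real (cos (real k * t))) = integral {0..pi} ?F"
      unfolding integral_open_interval_real using eq by (rule integral_cong)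
    finally show ?thesis by (simp only: higher_deriv_jcoeff[OF r cont])
  qed

  \<comment> \<open>The factor k powr (- 2 s - 1) is exp (c s + d) with c = -2 ln k, so i
    derivatives falling on it bring down (-2 ln k)^i.\<close>
  have leibniz: "(deriv ^^ \<mu>) (jcoeff g1 k) (of_real \<gamma>) =
      of_real (1 / real k powr (2 * \<gamma> + 1)) *
      (\<Sum>i=0..\<mu>. of_nat (\<mu> choose i) * of_real (- 2 * ln (real k)) ^ i * (deriv ^^ (\<mu> - i)) (G k) (of_real \<gamma>))"
    if k: "k \<ge> 1" for k
  proof -
    define c where "c = complex_of_real (- 2 * ln (real k))"
    define d where "d = complex_of_real (- ln (real k))"
    have pw: "of_nat k powr z = exp (z * of_real (ln (real k)))" for z :: complex
      using k by (simp add: powr_def Ln_of_nat)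
    have "exp (c * s + d) * of_nat k powr (2 * s + 1) = 1" for s
      unfolding pw exp_add[symmetric] by (simp add: c_def d_def algebra_simps)
    then have "jcoeff g1 k = (\<lambda>s. exp (c * s + d) * G k s)"
      unfolding G_def by (simp add: mult.assoc[symmetric])
    moreover have "(deriv ^^ \<mu>) (\<lambda>s. exp (c * s + d) * G k s) (of_real \<gamma>) =
      (\<Sum>i=0..\<mu>. of_nat (\<mu> choose i) * (deriv ^^ i) (\<lambda>s. exp (c * s + d)) (of_real \<gamma>) * (deriv ^^ (\<mu> - i)) (G k) (of_real \<gamma>))"
    proof (rule higher_deriv_mult)
      show "G k holomorphic_on ball (of_real \<gamma>) r"
        unfolding G_def using k by (intro holomorphic_intros jcoeff_holomorphic r cont) auto
    qed (use r in \<open>auto intro!: holomorphic_intros\<close>)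
    moreover have "exp (c * of_real \<gamma> + d) = of_real (1 / real k powr (2 * \<gamma> + 1))"
    proof -
      have "exp (c * of_real \<gamma> + d) = exp (of_real (- ((2 * \<gamma> + 1) * ln (real k))))"
        by (simp add: c_def d_def algebra_simps)
      also have "\<dots> = of_real (exp (- ((2 * \<gamma> + 1) * ln (real k))))" by (rule exp_of_real)
      finally show ?thesis using k by (simp add: powr_def exp_minus divide_inverse)
    qed
    ultimately show ?thesis
      unfolding higher_deriv_exp_linear sum_distrib_left c_def[symmetric] by (simp only: mult_ac)
  qed

  \<comment> \<open>Only i = \<mu> and i = \<mu> - 1 survive, because \<open>e\<close> vanishes
    beyond 1.\<close>
  have main: "of_real (lead_coeff_ln \<gamma> \<mu>) * g1 1 * of_real (ln (real k) ^ \<mu> / real k powr (2 * \<gamma> + 1))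
      + of_real (sec_coeff_ln \<gamma> \<mu>) * g1 1 * of_real (ln (real k) ^ (\<mu> - 1) / real k powr (2 * \<gamma> + 1))
    = of_real (2 / pi) * (of_real (1 / real k powr (2 * \<gamma> + 1)) *
      (\<Sum>i=0..\<mu>. of_nat (\<mu> choose i) * of_real (- 2 * ln (real k)) ^ i * e (\<mu> - i)))" for k
  proof -
    have "(\<Sum>i=0..\<mu>. of_nat (\<mu> choose i) * of_real (- 2 * ln (real k)) ^ i * e (\<mu> - i))
       = (\<Sum>i\<in>{\<mu> - 1, \<mu>}. of_nat (\<mu> choose i) * of_real (- 2 * ln (real k)) ^ i * e (\<mu> - i))"
      by (rule sum.mono_neutral_right) (auto simp: e_def)
    also have "\<dots> = of_nat \<mu> * of_real (- 2 * ln (real k)) ^ (\<mu> - 1) * e 1 + of_real (- 2 * ln (real k)) ^ \<mu> * e 0"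
      using assms(2) by (cases \<mu>) auto
    also have "e 1 = g1 1 * of_real (deriv lead_real \<gamma>)"
      using deriv_lead_fun_of_real[OF r] by (simp add: e_def D_def)
    also have "e 0 = g1 1 * of_real (lead_real \<gamma>)"
      using lead_fun_of_real[OF assms(1)] by (simp add: e_def D_def)
    finally have S: "(\<Sum>i=0..\<mu>. of_nat (\<mu> choose i) * of_real (- 2 * ln (real k)) ^ i * e (\<mu> - i))
       = of_nat \<mu> * of_real (- 2 * ln (real k)) ^ (\<mu> - 1) * (g1 1 * of_real (deriv lead_real \<gamma>))
         + of_real (- 2 * ln (real k)) ^ \<mu> * (g1 1 * of_real (lead_real \<gamma>))" .
    have pw: "complex_of_real (- 2 * ln (real k)) ^ n = of_real ((- 2) ^ n * ln (real k) ^ n)" for n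
      by (simp only: of_real_power[symmetric] power_mult_distrib)
    show ?thesis
      unfolding lead_coeff_ln_eq sec_coeff_ln_eq[OF assms(2,1)] S unfolding pw
      by (simp add: distrib_left divide_inverse mult_ac)
  qed

  \<comment> \<open>From k = 3 on, ln k \<ge> 1, so powers of ln k increase with the exponent. The
    bound is written as a quotient because for \<mu> = 1 the exponent \<mu> - 2 is negative.\<close>
  have term_bound: "norm (of_real (- 2 * ln (real k)) ^ i * ((deriv ^^ (\<mu> - i)) (G k) (of_real \<gamma>) - e (\<mu> - i)))
      \<le> K i * (ln (real k) ^ \<mu> / (ln (real k))\<^sup>2)" if k: "k \<ge> 3" and i: "i \<le> \<mu>" for k i
  proof -
    define L where "L = ln (real k)"
    define X where "X = norm ((deriv ^^ (\<mu> - i)) (G k) (of_real \<gamma>) - e (\<mu> - i))"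
    have L: "L \<ge> 1"
      unfolding L_def using k exp_le by (subst ln_ge_iff) auto
    have Ck: "norm ((deriv ^^ (\<mu> - i)) (G k) (of_real \<gamma>) - g1 1 * D (\<mu> - i)) \<le> C (\<mu> - i) / real k"
      using M(2)[of k "\<mu> - i"] k by (simp add: C_def D_def)
    have "L ^ i * X \<le> (4 * C (\<mu> - i) + norm (g1 1 * D (\<mu> - i))) * (L ^ \<mu> / L\<^sup>2)"
    \<comment> \<open>With at most one derivative on \<open>G\<close>, the limit is subtracted and
      the error O(1/k) beats 1 / (ln k)^2. With two or more, at most \<mu> - 2 logarithms remain and
      boundedness of the derivative suffices.\<close>
    proof (cases "\<mu> - i \<le> 1")
      case True
      have "X \<le> C (\<mu> - i) / real k" using Ck True by (simp add: X_def e_def)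
      also have "\<dots> \<le> C (\<mu> - i) / (L\<^sup>2 / 4)"
        using ln_squared_le[of k] k L C0 unfolding L_def[symmetric] by (intro divide_left_mono) auto
      finally have "L ^ i * X \<le> L ^ \<mu> * (4 * C (\<mu> - i) / L\<^sup>2)"
        using L i by (intro mult_mono power_increasing) (auto simp: X_def mult.commute)
      also have "\<dots> = 4 * C (\<mu> - i) * (L ^ \<mu> / L\<^sup>2)" by simp
      also have "\<dots> \<le> (4 * C (\<mu> - i) + norm (g1 1 * D (\<mu> - i))) * (L ^ \<mu> / L\<^sup>2)"
        using L by (intro mult_right_mono) auto
      finally show ?thesis .
    next
      case False
      have "X = norm (((deriv ^^ (\<mu> - i)) (G k) (of_real \<gamma>) - g1 1 * D (\<mu> - i)) + g1 1 * D (\<mu> - i))"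
        using False by (simp add: X_def e_def)
      also have "\<dots> \<le> C (\<mu> - i) / real k + norm (g1 1 * D (\<mu> - i))"
        using Ck by (intro order_trans[OF norm_triangle_ineq] add_right_mono)
      also have "C (\<mu> - i) / real k \<le> C (\<mu> - i) / 1"
        using k C0 by (intro divide_left_mono) auto
      finally have X: "X \<le> 4 * C (\<mu> - i) + norm (g1 1 * D (\<mu> - i))" using C0[of "\<mu> - i"] by linarith
      \<comment> \<open>Here i + 2 \<le> \<mu>, so the subtraction of natural numbers is
        exact.\<close>
      have "L ^ i \<le> L ^ (\<mu> - 2)" using L False by (intro power_increasing) auto
      also have "\<dots> = L ^ \<mu> / L\<^sup>2" using L False by (subst power_diff) auto
      finally have "L ^ i * X \<le> (L ^ \<mu> / L\<^sup>2) * (4 * C (\<mu> - i) + norm (g1 1 * D (\<mu> - i)))"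
        using X L by (intro mult_mono) (auto simp: X_def)
      then show ?thesis by (simp only: mult.commute)
    qed
    then have "2 ^ i * (L ^ i * X) \<le> 2 ^ i * ((4 * C (\<mu> - i) + norm (g1 1 * D (\<mu> - i))) * (L ^ \<mu> / L\<^sup>2))"
      by (intro mult_left_mono) auto
    moreover have "norm (complex_of_real (- 2 * L) ^ i) = 2 ^ i * L ^ i"
      using L by (simp add: norm_power norm_mult power_mult_distrib)
    ultimately show ?thesis
      unfolding K_def norm_mult X_def[symmetric] L_def[symmetric] by (simp add: mult.assoc)
  qed

  show ?thesis
  proof (rule bigoI)
    show "\<forall>\<^sub>F k in sequentially. norm (cheb_coeff f k
            - (of_real (lead_coeff_ln \<gamma> \<mu>) * g1 1 * of_real (ln (real k) ^ \<mu> / real k powr (2 * \<gamma> + 1))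
               + of_real (sec_coeff_ln \<gamma> \<mu>) * g1 1 * of_real (ln (real k) ^ (\<mu> - 1) / real k powr (2 * \<gamma> + 1))))
        \<le> (2 / pi * (\<Sum>i=0..\<mu>. real (\<mu> choose i) * K i)) *
          norm (complex_of_real (ln (real k) powi (int \<mu> - 2) / real k powr (2 * \<gamma> + 1)))"
      using eventually_ge_at_top[of 3]
    proof eventually_elim
      case (elim k)
      then have k: "k \<ge> 1" by simp
      define L where "L = ln (real k)"
      define p where "p = 1 / real k powr (2 * \<gamma> + 1)"
      have p: "p \<ge> 0" by (simp add: p_def)
      have L: "L \<ge> 1"
        unfolding L_def using elim exp_le by (subst ln_ge_iff) auto
      define Y where "Y = (\<lambda>i. of_real (- 2 * L) ^ i * ((deriv ^^ (\<mu> - i)) (G k) (of_real \<gamma>) - e (\<mu> - i)))"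
      have "norm (of_real (2 / pi) * (of_real p * (\<Sum>i=0..\<mu>. of_nat (\<mu> choose i) * Y i)))
         = 2 / pi * (p * norm (\<Sum>i=0..\<mu>. of_nat (\<mu> choose i) * Y i))"
        using p by (simp add: norm_mult norm_divide)
      also have "\<dots> \<le> 2 / pi * (p * (\<Sum>i=0..\<mu>. real (\<mu> choose i) * (K i * (L ^ \<mu> / L\<^sup>2))))"
      proof (intro mult_left_mono sum_norm_le p)
        fix i assume "i \<in> {0..\<mu>}"
        then have "norm (Y i) \<le> K i * (L ^ \<mu> / L\<^sup>2)"
          using term_bound[OF elim, of i] by (simp only: Y_def L_def) simp
        then show "norm (of_nat (\<mu> choose i) * Y i) \<le> real (\<mu> choose i) * (K i * (L ^ \<mu> / L\<^sup>2))"
          by (simp only: norm_mult norm_of_nat mult_left_mono of_nat_0_le_iff)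
      qed auto
      also have "\<dots> = (2 / pi * (\<Sum>i=0..\<mu>. real (\<mu> choose i) * K i)) * (L ^ \<mu> / L\<^sup>2 * p)"
        by (simp add: sum_distrib_left sum_distrib_right mult_ac)
      also have "L ^ \<mu> / L\<^sup>2 = L powi (int \<mu> - 2)"
        using L by (simp add: power_int_diff)
      also have "L powi (int \<mu> - 2) * p = norm (complex_of_real (L powi (int \<mu> - 2) / real k powr (2 * \<gamma> + 1)))"
        using L by (simp add: p_def norm_divide norm_power_int)
      finally have "norm (of_real (2 / pi) * (of_real p * (\<Sum>i=0..\<mu>. of_nat (\<mu> choose i) * Y i)))
        \<le> (2 / pi * (\<Sum>i=0..\<mu>. real (\<mu> choose i) * K i)) *
          norm (complex_of_real (L powi (int \<mu> - 2) / real k powr (2 * \<gamma> + 1)))" .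
      moreover have "(\<Sum>i=0..\<mu>. of_nat (\<mu> choose i) * Y i) =
         (\<Sum>i=0..\<mu>. of_nat (\<mu> choose i) * of_real (- 2 * L) ^ i * (deriv ^^ (\<mu> - i)) (G k) (of_real \<gamma>))
         - (\<Sum>i=0..\<mu>. of_nat (\<mu> choose i) * of_real (- 2 * L) ^ i * e (\<mu> - i))"
        unfolding sum_subtractf[symmetric] Y_def by (simp only: right_diff_distrib mult.assoc)
      ultimately show ?case
        unfolding cheb leibniz[OF k] main unfolding L_def[symmetric] p_def[symmetric] by (simp only: right_diff_distrib)
    qed
  qed
qed

end
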